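(* Suppose that for each $t\in\{1,\dots,T-1\}$ the state space $\mathcal X_t\subset\mathbb R^{d_t}$ is contained in a ball of diameter $D_t>0$. Then for the nonconsecutive dual dynamic programming (NDDP) algorithm with predetermined approximation gap vector $(\delta_t)_{t=1}^T$ satisfying $\varepsilon=\delta_1>\delta_2>\cdots>\delta_T=0$, the total number $\#\mathrm{Eval}_{\mathrm{NDDP}}$ of subproblem oracle evaluations (initial stage and noninitial stage) before termination is bounded by $$\#\mathrm{Eval}_{\mathrm{NDDP}}\le 1+2\cdot\sum_{t=1}^{T-1}\left(1+\frac{2M_{t+1}D_t}{\delta_t-\delta_{t+1}}\right)^{d_t}.$$
   Context: **Problem.** Let $T\ge 2$, $\mathcal T=\{1,\dots,T\}$, $\mathcal T'=\{2,\dots,T\}$. For $t\in\mathcal T$, $\mathcal X_t\subset\mathbb R^{d_t}$ is a nonempty compact convex set (state space); $\Xi_t\subseteq\mathbb R^{m_t}$ is a nonempty uncertainty set (a Borel set; convex or finite); $x_0\in\mathbb R^{d_0}$ and $\xi_1$ are fixed deterministic parameters ($\mathcal X_0=\{x_0\}$, $\Xi_1=\{\xi_1\}$). The cost $f_t:\mathbb R^{d_{t-1}}\times\mathbb R^{d_t}\times\Xi_t\to[0,+\infty]$, $(x_{t-1},x_t,\xi_t)\mapsto f_t(x_{t-1},x_t;\xi_t)$, is lower semicontinuous and is convex in $(x_{t-1},x_t)$ for each $\xi_t$. For $t\in\mathcal T'$, $\mathcal P_t$ is a nonempty set of Borel probability measures on $\Xi_t$. There is $x_1\in\mathcal X_1$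 with $f_1(x_0,x_1;\xi_1)<+\infty$. $\|\cdot\|$ is a norm on each $\mathbb R^{d_t}$ (balls are with respect to this norm), and $\|\cdot\|_*$ is its dual norm. **Regularized cost-to-go functions.** Fix $M_t>0$ for $t\in\mathcal T'$. Put $\mathcal Q_T^{\mathrm R}\equiv0$ and, for $t=T,\dots,2$, $$Q_t^{\mathrm R}(x_{t-1};\xi_t)=\max_{\|\lambda_t\|_*\le M_t}\ \inf_{x_t\in\mathcal X_t,\,z_t\in\mathbb R^{d_{t-1}}} f_t(z_t,x_t;\xi_t)+\mathcal Q_t^{\mathrm R}(x_t)+\langle\lambda_t,x_{t-1}-z_t\rangle,$$ $$\mathcal Q_{t-1}^{\mathrm R}(x_{t-1})=\sup_{p_t\in\mathcal P_t}\mathbb E_{\xi_t\sim p_t}Q_t^{\mathrm R}(x_{t-1};\xi_t).$$ **Single stage subproblem oracles.** Let $\underline{\mathcal Q}_t,\overline{\mathcal Q}_t$ be lower semicontinuous convex functions with values in $\mathbb R\cup\{+\infty\}$ and $\underline{\mathcal Q}_t\le\mathcal Q_t^{\mathrm R}\le\overline{\mathcal Q}_t$ on $\mathcal X_t$ (in the algorithm $\underline{\mathcal Q}_t$ is always real-valued). *Initial stage oracle* $\mathscr O_1:(\underline{\mathcal Q}_1,\overline{\mathcal Q}_1)\mapsto(x_1;\gamma_1)$: returns an optimal solution $x_1$ of $\min_{x_1\in\mathcal X_1}f_1(x_0,x_1;\xi_1)+\underline{\mathcal Q}_1(x_1)$ and $\gamma_1=\overline{\mathcal Q}_1(x_1)-\underline{\mathcal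 Q}_1(x_1)$. *Noninitial stage oracle* ($t\in\mathcal T'$) $\mathscr O_t:(x_{t-1},\underline{\mathcal Q}_t,\overline{\mathcal Q}_t)\mapsto(\mathcal V_{t-1},v_{t-1},x_t;\gamma_t)$: given $x_{t-1}\in\mathcal X_{t-1}$, returns some $x_t\in\mathcal X_t$, an $M_t$-Lipschitz affine function $\mathcal V_{t-1}$ and a value $v_{t-1}\in\mathbb R\cup\{+\infty\}$ such that $\mathcal V_{t-1}\le\mathcal Q_{t-1}^{\mathrm R}$ on $\mathcal X_{t-1}$, $v_{t-1}\ge\mathcal Q_{t-1}^{\mathrm R}(x_{t-1})$, and $v_{t-1}-\mathcal V_{t-1}(x_{t-1})\le\gamma_t:=\overline{\mathcal Q}_t(x_t)-\underline{\mathcal Q}_t(x_t)$. Any oracles satisfying these requirements may be used. **Notation.** $\mathrm{conv}\{h_1,h_2\}(x)=\sup_\lambda\inf_z\{\min\{h_1(z),h_2(z)\}+\langle\lambda,x-z\rangle\}$ (closed convex hull of the epigraphs). **NDDP algorithm.** Input: oracles $\mathscr O_t$, $t\in\mathcal T$, and gaps $\varepsilon=\delta_1>\delta_2>\cdots>\delta_T=0$. The algorithm maintains current approximations $\underline{\mathcal Q}_t,\overline{\mathcal Q}_t$ and current states $x_t$. Initialize $\underline{\mathcal Q}_t=0$, $\overline{\mathcal Q}_t=+\infty$ for $t<T$; $\underline{\mathcal Q}_T=\overline{\mathcal Q}_T=0$ (never changed); $\mathrm{LB}=0$, $\mathrm{UB}=+\infty$; current stage $t=1$. Repeat: (a) If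 $t=1$: evaluate $(x_1;\gamma_1)=\mathscr O_1(\underline{\mathcal Q}_1,\overline{\mathcal Q}_1)$ (replacing the current state $x_1$); set $\mathrm{LB}=f_1(x_0,x_1;\xi_1)+\underline{\mathcal Q}_1(x_1)$, $\mathrm{UB}'=f_1(x_0,x_1;\xi_1)+\overline{\mathcal Q}_1(x_1)$; if $\mathrm{UB}'<\mathrm{UB}$, set $x_1^*=x_1$ and $\mathrm{UB}=\mathrm{UB}'$. If $\mathrm{UB}-\mathrm{LB}\le\varepsilon$, terminate and return $x_1^*$; otherwise set $t\leftarrow2$. (b) If $t\ge2$: evaluate $(\mathcal V_{t-1},v_{t-1},x_t;\gamma_t)=\mathscr O_t(x_{t-1},\underline{\mathcal Q}_t,\overline{\mathcal Q}_t)$ at the current state $x_{t-1}$ (replacing the current state $x_t$). If $t<T$ and $\gamma_t>\delta_t$, set $t\leftarrow t+1$ with no update of approximations. Otherwise update $\underline{\mathcal Q}_{t-1}\leftarrow\max\{\underline{\mathcal Q}_{t-1},\mathcal V_{t-1}\}$, $\overline{\mathcal Q}_{t-1}\leftarrow\mathrm{conv}\{\overline{\mathcal Q}_{t-1},\,v_{t-1}+M_t\|\cdot-x_{t-1}\|\}$, and set $t\leftarrow t-1$. *)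

theory Defs
  imports "HOL-Probability.Probability" "HOL-Analysis.Finite_Function_Topology"
begin

text \<open>
  The dimensions of the state and uncertainty spaces depend on the stage, so the Euclidean space of
  dimension \<open>d\<close> is realised inside the real normed vector space of finitely supported real sequences,
  as the subspace of the sequences supported on \<open>{..<d}\<close>.  The norm of the ambient space only
  supplies the topology and the Borel sets of this subspace, which are the usual ones; the norm of
  the problem is a separate, arbitrary norm.
\<close>

type_synonym vec = "(nat, real) poly_mapping"

definition Rn :: "nat \<Rightarrow> vec set" where
  "Rn d = {x. \<forall>i\<ge>d. Poly_Mapping.lookup x i = 0}"

definition dot :: "nat \<Rightarrow> vec \<Rightarrow> vec \<Rightarrow> real" where
  "dot d x y = (\<Sum>i<d. Poly_Mapping.lookup x i * Poly_Mapping.lookup y i)"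

definition is_norm :: "nat \<Rightarrow> (vec \<Rightarrow> real) \<Rightarrow> bool" where
  "is_norm d N \<longleftrightarrow>
     (\<forall>x\<in>Rn d. 0 \<le> N x) \<and>
     (\<forall>x\<in>Rn d. N x = 0 \<longleftrightarrow> x = 0) \<and>
     (\<forall>c. \<forall>x\<in>Rn d. N (c *\<^sub>R x) = \<bar>c\<bar> * N x) \<and>
     (\<forall>x\<in>Rn d. \<forall>y\<in>Rn d. N (x + y) \<le> N x + N y)"

definition dual_norm :: "nat \<Rightarrow> (vec \<Rightarrow> real) \<Rightarrow> vec \<Rightarrow> real" where
  "dual_norm d N l = (SUP x\<in>{x \<in> Rn d. N x \<le> 1}. dot d l x)"

definition lsc_on :: "'a::topological_space set \<Rightarrow> ('a \<Rightarrow> ereal) \<Rightarrow> bool" where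
  "lsc_on S f \<longleftrightarrow> (\<forall>a. closedin (top_of_set S) {x \<in> S. f x \<le> a})"

text \<open>Convexity of the epigraph, as for the library's \<^const>\<open>epigraph\<close> of a real-valued function.\<close>

definition ereal_convex_on :: "'a::real_vector set \<Rightarrow> ('a \<Rightarrow> ereal) \<Rightarrow> bool" where
  "ereal_convex_on S f \<longleftrightarrow> convex {(x, r). x \<in> S \<and> f x \<le> ereal r}"

text \<open>
  \<open>cost pb t z x \<xi>\<close> is the cost $f_t(z, x; \xi)$ of moving from the state \<open>z\<close> of stage \<open>t - 1\<close> to the
  state \<open>x\<close> of stage \<open>t\<close>; \<open>snorm pb t\<close> is the norm on the state space of stage \<open>t\<close>, and
  \<open>reg pb t\<close> is the regularization factor $M_t$.
\<close>

record problem =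
  horizon :: nat
  sdim :: "nat \<Rightarrow> nat"
  udim :: "nat \<Rightarrow> nat"
  states :: "nat \<Rightarrow> vec set"
  uncert :: "nat \<Rightarrow> vec set"
  init_state :: vec
  init_uncert :: vec
  cost :: "nat \<Rightarrow> vec \<Rightarrow> vec \<Rightarrow> vec \<Rightarrow> ereal"
  ambiguity :: "nat \<Rightarrow> vec measure set"
  snorm :: "nat \<Rightarrow> vec \<Rightarrow> real"
  reg :: "nat \<Rightarrow> real"

definition valid_problem :: "problem \<Rightarrow> bool" where
  "valid_problem pb \<longleftrightarrow>
     2 \<le> horizon pb \<and>
     (\<forall>t\<in>{0..horizon pb}. is_norm (sdim pb t) (snorm pb t)) \<and>
     init_state pb \<in> Rn (sdim pb 0) \<and> states pb 0 = {init_state pb} \<and>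
     uncert pb 1 = {init_uncert pb} \<and>
     (\<forall>t\<in>{1..horizon pb}.
        states pb t \<subseteq> Rn (sdim pb t) \<and> states pb t \<noteq> {} \<and>
        compact (states pb t) \<and> convex (states pb t)) \<and>
     (\<forall>t\<in>{1..horizon pb}.
        uncert pb t \<noteq> {} \<and> uncert pb t \<in> sets (restrict_space borel (Rn (udim pb t))) \<and>
        (convex (uncert pb t) \<or> finite (uncert pb t))) \<and>
     (\<forall>t\<in>{1..horizon pb}.
        (\<forall>z\<in>Rn (sdim pb (t - 1)). \<forall>x\<in>Rn (sdim pb t). \<forall>\<xi>\<in>uncert pb t. 0 \<le> cost pb t z x \<xi>) \<and>
        lsc_on (Rn (sdim pb (t - 1)) \<times> Rn (sdim pb t) \<times> uncert pb t)
          (\<lambda>(z, x, \<xi>). cost pb t z x \<xi>) \<and>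
        (\<forall>\<xi>\<in>uncert pb t.
           ereal_convex_on (Rn (sdim pb (t - 1)) \<times> Rn (sdim pb t)) (\<lambda>(z, x). cost pb t z x \<xi>))) \<and>
     (\<forall>t\<in>{2..horizon pb}.
        ambiguity pb t \<noteq> {} \<and>
        (\<forall>p\<in>ambiguity pb t. prob_space p \<and> sets p = sets (restrict_space borel (uncert pb t)))) \<and>
     (\<exists>x\<in>states pb 1. cost pb 1 (init_state pb) x (init_uncert pb) < \<infinity>) \<and>
     (\<forall>t\<in>{2..horizon pb}. 0 < reg pb t)"

text \<open>
  \<open>stage_value pb t Q x \<xi>\<close> is $Q_t^R(x; \xi)$ when \<open>Q\<close> is the regularized expected cost-to-go function of
  stage \<open>t\<close>.  It is nonnegative (take \<open>l = 0\<close>), so that no information is lost when it is converted to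
  an extended nonnegative real for the expectation below.
\<close>

definition stage_value :: "problem \<Rightarrow> nat \<Rightarrow> (vec \<Rightarrow> ereal) \<Rightarrow> vec \<Rightarrow> vec \<Rightarrow> ereal" where
  "stage_value pb t Q x \<xi> =
     (SUP l\<in>{l \<in> Rn (sdim pb (t - 1)). dual_norm (sdim pb (t - 1)) (snorm pb (t - 1)) l \<le> reg pb t}.
      INF (y, z)\<in>states pb t \<times> Rn (sdim pb (t - 1)).
        cost pb t z y \<xi> + Q y + ereal (dot (sdim pb (t - 1)) l (x - z)))"

function reg_ctg :: "problem \<Rightarrow> nat \<Rightarrow> vec \<Rightarrow> ereal" where
  "reg_ctg pb t =
     (if horizon pb \<le> t then (\<lambda>x. 0)
      else (\<lambda>x. SUP p\<in>ambiguity pb (Suc t).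
        enn2ereal (\<integral>\<^sup>+ \<xi>. e2ennreal (stage_value pb (Suc t) (reg_ctg pb (Suc t)) x \<xi>) \<partial>p)))"
  by auto
termination
  by (relation "Wellfounded.measure (\<lambda>(pb, t). horizon pb - t)") auto

declare reg_ctg.simps [simp del]

text \<open>
  The admissible oracle inputs.  Under-approximations are taken real-valued, as they always are in
  the algorithm, so that the gap \<open>up x - low x\<close> never has the form $\infty - \infty$.
\<close>

definition approx_pair :: "problem \<Rightarrow> nat \<Rightarrow> (vec \<Rightarrow> ereal) \<Rightarrow> (vec \<Rightarrow> ereal) \<Rightarrow> bool" where
  "approx_pair pb t low up \<longleftrightarrow>
     lsc_on (Rn (sdim pb t)) low \<and> ereal_convex_on (Rn (sdim pb t)) low \<and>
     lsc_on (Rn (sdim pb t)) up \<and> ereal_convex_on (Rn (sdim pb t)) up \<and>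
     (\<forall>x\<in>Rn (sdim pb t). \<bar>low x\<bar> \<noteq> \<infinity> \<and> up x \<noteq> -\<infinity>) \<and>
     (\<forall>x\<in>states pb t. low x \<le> reg_ctg pb t x \<and> reg_ctg pb t x \<le> up x)"

definition affine_fun :: "nat \<Rightarrow> (vec \<Rightarrow> real) \<Rightarrow> bool" where
  "affine_fun d V \<longleftrightarrow> (\<exists>a\<in>Rn d. \<exists>b. \<forall>x\<in>Rn d. V x = dot d a x + b)"

definition lipschitz_fun :: "nat \<Rightarrow> (vec \<Rightarrow> real) \<Rightarrow> real \<Rightarrow> (vec \<Rightarrow> real) \<Rightarrow> bool" where
  "lipschitz_fun d N L V \<longleftrightarrow> (\<forall>x\<in>Rn d. \<forall>y\<in>Rn d. \<bar>V x - V y\<bar> \<le> L * N (x - y))"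

type_synonym initial_oracle =
  "(vec \<Rightarrow> ereal) \<Rightarrow> (vec \<Rightarrow> ereal) \<Rightarrow> vec \<times> ereal"

type_synonym stage_oracle =
  "vec \<Rightarrow> (vec \<Rightarrow> ereal) \<Rightarrow> (vec \<Rightarrow> ereal) \<Rightarrow> (vec \<Rightarrow> real) \<times> ereal \<times> vec \<times> ereal"

definition valid_initial_oracle :: "problem \<Rightarrow> initial_oracle \<Rightarrow> bool" where
  "valid_initial_oracle pb orc \<longleftrightarrow>
     (\<forall>low up. approx_pair pb 1 low up \<longrightarrow>
       (case orc low up of (x, \<gamma>) \<Rightarrow>
          x \<in> states pb 1 \<and>
          (\<forall>y\<in>states pb 1.
             cost pb 1 (init_state pb) x (init_uncert pb) + low x
             \<le> cost pb 1 (init_state pb) y (init_uncert pb) + low y) \<and>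
          \<gamma> = up x - low x))"

definition valid_stage_oracle :: "problem \<Rightarrow> nat \<Rightarrow> stage_oracle \<Rightarrow> bool" where
  "valid_stage_oracle pb t orc \<longleftrightarrow>
     (\<forall>x low up. x \<in> states pb (t - 1) \<and> approx_pair pb t low up \<longrightarrow>
       (case orc x low up of (V, v, y, \<gamma>) \<Rightarrow>
          y \<in> states pb t \<and>
          affine_fun (sdim pb (t - 1)) V \<and>
          lipschitz_fun (sdim pb (t - 1)) (snorm pb (t - 1)) (reg pb t) V \<and>
          v \<noteq> -\<infinity> \<and>
          (\<forall>z\<in>states pb (t - 1). ereal (V z) \<le> reg_ctg pb (t - 1) z) \<and>
          reg_ctg pb (t - 1) x \<le> v \<and>
          v - ereal (V x) \<le> \<gamma> \<and>
          \<gamma> = up y - low y))"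

definition conv_min :: "nat \<Rightarrow> (vec \<Rightarrow> ereal) \<Rightarrow> (vec \<Rightarrow> ereal) \<Rightarrow> vec \<Rightarrow> ereal" where
  "conv_min d h1 h2 x = (SUP l\<in>Rn d. INF z\<in>Rn d. min (h1 z) (h2 z) + ereal (dot d l (x - z)))"

record nddp_state =
  cur_stage :: nat
  under :: "nat \<Rightarrow> vec \<Rightarrow> ereal"
  over :: "nat \<Rightarrow> vec \<Rightarrow> ereal"
  cur_state :: "nat \<Rightarrow> vec"
  lbound :: ereal
  ubound :: ereal
  incumbent :: "vec option"
  terminated :: bool

text \<open>
  For \<open>t \<ge> 1\<close>, \<open>cur_state\<close> is overwritten by stage \<open>t\<close> before it is read, so its initial value is irrelevant.
\<close>

definition nddp_init :: "problem \<Rightarrow> nddp_state" where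
  "nddp_init pb =
     \<lparr>cur_stage = 1,
      under = (\<lambda>t x. 0),
      over = (\<lambda>t x. if t < horizon pb then \<infinity> else 0),
      cur_state = (\<lambda>t. if t = 0 then init_state pb else 0),
      lbound = 0, ubound = \<infinity>, incumbent = None, terminated = False\<rparr>"

definition nddp_initial_step ::
    "problem \<Rightarrow> initial_oracle \<Rightarrow> real \<Rightarrow> nddp_state \<Rightarrow> nddp_state" where
  "nddp_initial_step pb orc1 \<epsilon> s =
     (let (x, \<gamma>) = orc1 (under s 1) (over s 1);
          c = cost pb 1 (init_state pb) x (init_uncert pb);
          lb = c + under s 1 x;
          ub' = c + over s 1 x;
          ub = (if ub' < ubound s then ub' else ubound s);
          best = (if ub' < ubound s then Some x else incumbent s);
          s' = s\<lparr>cur_state := (cur_state s)(1 := x), lbound := lb, ubound := ub, incumbent := best\<rparr>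
      in if ub - lb \<le> ereal \<epsilon> then s'\<lparr>terminated := True\<rparr> else s'\<lparr>cur_stage := 2\<rparr>)"

definition nddp_stage_step ::
    "problem \<Rightarrow> (nat \<Rightarrow> stage_oracle) \<Rightarrow> (nat \<Rightarrow> real) \<Rightarrow> nddp_state \<Rightarrow> nddp_state" where
  "nddp_stage_step pb orc \<delta> s =
     (let t = cur_stage s;
          xp = cur_state s (t - 1);
          (V, v, x, \<gamma>) = orc t xp (under s t) (over s t);
          s' = s\<lparr>cur_state := (cur_state s)(t := x)\<rparr>
      in if t < horizon pb \<and> \<gamma> > ereal (\<delta> t) then s'\<lparr>cur_stage := t + 1\<rparr>
         else s'\<lparr>under := (under s)(t - 1 := (\<lambda>z. max (under s (t - 1) z) (ereal (V z)))),
                 over := (over s)(t - 1 := conv_min (sdim pb (t - 1)) (over s (t - 1))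
                            (\<lambda>z. v + ereal (reg pb t * snorm pb (t - 1) (z - xp)))),
                 cur_stage := t - 1\<rparr>)"

text \<open>Every step from a state that is not terminated makes exactly one oracle evaluation.\<close>

definition nddp_step ::
    "problem \<Rightarrow> initial_oracle \<Rightarrow> (nat \<Rightarrow> stage_oracle) \<Rightarrow> real \<Rightarrow> (nat \<Rightarrow> real) \<Rightarrow>
     nddp_state \<Rightarrow> nddp_state" where
  "nddp_step pb orc1 orc \<epsilon> \<delta> s =
     (if terminated s then s
      else if cur_stage s = 1 then nddp_initial_step pb orc1 \<epsilon> s
      else nddp_stage_step pb orc \<delta> s)"

definition nddp_run ::
    "problem \<Rightarrow> initial_oracle \<Rightarrow> (nat \<Rightarrow> stage_oracle) \<Rightarrow> real \<Rightarrow> (nat \<Rightarrow> real) \<Rightarrow>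
     nat \<Rightarrow> nddp_state" where
  "nddp_run pb orc1 orc \<epsilon> \<delta> n = (nddp_step pb orc1 orc \<epsilon> \<delta> ^^ n) (nddp_init pb)"

definition nddp_terminates ::
    "problem \<Rightarrow> initial_oracle \<Rightarrow> (nat \<Rightarrow> stage_oracle) \<Rightarrow> real \<Rightarrow> (nat \<Rightarrow> real) \<Rightarrow> bool" where
  "nddp_terminates pb orc1 orc \<epsilon> \<delta> \<longleftrightarrow> (\<exists>n. terminated (nddp_run pb orc1 orc \<epsilon> \<delta> n))"

text \<open>The number of oracle evaluations; it is meaningful only for a terminating run.\<close>

definition nddp_evals ::
    "problem \<Rightarrow> initial_oracle \<Rightarrow> (nat \<Rightarrow> stage_oracle) \<Rightarrow> real \<Rightarrow> (nat \<Rightarrow> real) \<Rightarrow> nat" where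
  "nddp_evals pb orc1 orc \<epsilon> \<delta> = (LEAST n. terminated (nddp_run pb orc1 orc \<epsilon> \<delta> n))"

end

theory Submission
  imports Defs
begin

text \<open>
  Every evaluation that does not terminate the run moves the current stage either forward, from \<open>t\<close> to
  \<open>t + 1\<close>, or backward.  The run starts at stage 1, so the number of moves is at most twice the number
  of forward moves; the terminating evaluation adds one.  It remains to bound the number of forward
  moves from each stage \<open>t\<close>.

  A forward move from \<open>t\<close> happens at a state \<open>x\<close> where the gap between the two approximations exceeds
  \<open>\<delta> t\<close>.  Stage \<open>t\<close> is reached again only by a backward move from \<open>t + 1\<close>, which adds a cut at this
  \<open>x\<close> and is made only when the gap at stage \<open>t + 1\<close> is at most \<open>\<delta> (t + 1)\<close>; by the requirements on
  the oracle, this bounds the gap at \<open>x\<close> as well.  Both halves of the cut have Lipschitz constant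
  \<open>M = reg pb (t + 1)\<close>, so from then on the gap at any \<open>z\<close> is at most \<open>\<delta> (t + 1) + 2 M \<parallel>z - x\<parallel>\<close>
  (\<open>gap_near_update\<close>).  Hence the states of different forward moves from \<open>t\<close> are at distance at least
  \<open>r = (\<delta> t - \<delta> (t + 1)) / (2 M)\<close> from each other, and comparing the volumes of disjoint balls of radius
  \<open>r / 2\<close> with that of a ball of radius \<open>(D + r) / 2\<close> shows that there are at most \<open>(1 + D / r) ^ d\<close> of
  them (\<open>card_separated_le\<close>).  At stage 1 the role of the gap test is played by the termination test.
  The invariant \<open>nddp_inv\<close> collects the forward states of each stage, and \<open>nddp_step_inv\<close> keeps count.

  The requirements on the oracles bind only on valid approximations, so the approximations must be shown
  to remain valid.  The critical point is that the convex hull of two over-approximations is again one: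
  this needs the regularized cost-to-go function to be convex and Lipschitz on the whole space, for then
  it is the supremum of affine functions with slopes in the dual ball
  (\<open>lipschitz_convex_le_biconjugate\<close>).  These two properties are proved by backward induction over the
  stages (\<open>reg_ctg_lipschitz_convex_aux\<close>).  The maximum over the multipliers in the definition of the
  stage value equals the infimal convolution of the stage cost with \<open>M \<parallel>\<cdot>\<parallel>\<close>
  (\<open>SUP_dual_eq_inf_conv\<close>), because a subgradient of the latter is an optimal multiplier.  In this
  form the stage value is visibly convex and Lipschitz in the state, and it is lower semicontinuous,
  hence measurable, in the uncertain parameter, so that the expectation inherits convexity.
\<close>

section \<open>Convex and lower semicontinuous extended real functions\<close>

lemma ereal_convex_onI:
  assumes "convex S"
    and "\<And>x y r s u v. \<lbrakk>x \<in> S; y \<in> S; f x \<le> ereal r; f y \<le> ereal s; 0 \<le> u; 0 \<le> v; u + v = 1\<rbrakk>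
           \<Longrightarrow> f (u *\<^sub>R x + v *\<^sub>R y) \<le> ereal (u * r + v * s)"
  shows "ereal_convex_on S f"
  using assms unfolding ereal_convex_on_def convex_def by auto

lemma ereal_convex_onD:
  assumes "ereal_convex_on S f" "x \<in> S" "y \<in> S" "f x \<le> ereal r" "f y \<le> ereal s"
    "0 \<le> u" "0 \<le> v" "u + v = 1"
  shows "f (u *\<^sub>R x + v *\<^sub>R y) \<le> ereal (u * r + v * s)"
proof -
  have "u *\<^sub>R (x, r) + v *\<^sub>R (y, s) \<in> {(x, r). x \<in> S \<and> f x \<le> ereal r}"
    using assms unfolding ereal_convex_on_def by (intro convexD) auto
  then show ?thesis by simp
qed

lemma ereal_convex_on_add:
  assumes "convex S" "ereal_convex_on S f" "ereal_convex_on S g"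
    and nonneg: "\<And>x. x \<in> S \<Longrightarrow> 0 \<le> f x" "\<And>x. x \<in> S \<Longrightarrow> 0 \<le> g x"
  shows "ereal_convex_on S (\<lambda>x. f x + g x)"
proof (rule ereal_convex_onI[OF assms(1)])
  fix x y r s u v
  assume xy: "x \<in> S" "y \<in> S" and r: "f x + g x \<le> ereal r" and s: "f y + g y \<le> ereal s"
    and uv: "0 \<le> u" "0 \<le> v" "u + v = (1::real)"
  have split: "\<exists>a b. f z \<le> ereal a \<and> g z \<le> ereal b \<and> a + b = q"
    if "z \<in> S" "f z + g z \<le> ereal q" for z q
  proof -
    from that nonneg[OF that(1)] obtain b where b: "g z = ereal b" "f z \<le> ereal (q - b)"
      by (cases "f z"; cases "g z") auto
    then show ?thesis by (intro exI[of _ "q - b"] exI[of _ b]) auto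
  qed
  obtain a b where 1: "f x \<le> ereal a" "g x \<le> ereal b" "a + b = r" using split[OF xy(1) r] by auto
  obtain c d where 2: "f y \<le> ereal c" "g y \<le> ereal d" "c + d = s" using split[OF xy(2) s] by auto
  have "f (u *\<^sub>R x + v *\<^sub>R y) + g (u *\<^sub>R x + v *\<^sub>R y) \<le> ereal (u * a + v * c) + ereal (u * b + v * d)"
    using ereal_convex_onD[OF assms(2) xy 1(1) 2(1) uv] ereal_convex_onD[OF assms(3) xy 1(2) 2(2) uv]
    by (rule add_mono)
  also have "\<dots> = ereal (u * r + v * s)"
    using 1 2 by (auto simp: algebra_simps)
  finally show "f (u *\<^sub>R x + v *\<^sub>R y) + g (u *\<^sub>R x + v *\<^sub>R y) \<le> ereal (u * r + v * s)" .
qed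

lemma ereal_convex_on_SUP:
  assumes "convex S" "\<And>i. i \<in> I \<Longrightarrow> ereal_convex_on S (f i)"
  shows "ereal_convex_on S (\<lambda>x. SUP i\<in>I. f i x)"
proof (rule ereal_convex_onI[OF assms(1)], rule SUP_least)
  fix x y r s u v i
  assume xy: "x \<in> S" "y \<in> S" and r: "(SUP i\<in>I. f i x) \<le> ereal r" and s: "(SUP i\<in>I. f i y) \<le> ereal s"
    and uv: "0 \<le> u" "0 \<le> v" "u + v = (1::real)" and i: "i \<in> I"
  show "f i (u *\<^sub>R x + v *\<^sub>R y) \<le> ereal (u * r + v * s)"
    using r s i by (intro ereal_convex_onD[OF assms(2)[OF i] xy _ _ uv]) (auto simp: SUP_le_iff)
qed

lemma ereal_convex_on_max:
  assumes "convex S" "ereal_convex_on S f" "ereal_convex_on S g"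
  shows "ereal_convex_on S (\<lambda>x. max (f x) (g x))"
  by (intro ereal_convex_onI[OF assms(1)])
     (auto intro: ereal_convex_onD[OF assms(2)] ereal_convex_onD[OF assms(3)])

lemma ereal_convex_on_compose:
  assumes "convex T" "ereal_convex_on S f" "\<And>x. x \<in> T \<Longrightarrow> g x \<in> S"
    and "\<And>x y u v. \<lbrakk>x \<in> T; y \<in> T; 0 \<le> u; 0 \<le> v; u + v = (1::real)\<rbrakk>
           \<Longrightarrow> g (u *\<^sub>R x + v *\<^sub>R y) = u *\<^sub>R g x + v *\<^sub>R g y"
  shows "ereal_convex_on T (\<lambda>x. f (g x))"
  by (intro ereal_convex_onI[OF assms(1)]) (simp add: assms(3,4) ereal_convex_onD[OF assms(2)])

text \<open>
  The epigraph of a partial infimum is, up to closure in the last coordinate, a linear image of the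
  epigraph of the whole function.
\<close>

lemma ereal_convex_on_INF:
  assumes "convex S" "convex W" "ereal_convex_on (S \<times> W) (\<lambda>(x, w). G x w)"
  shows "ereal_convex_on S (\<lambda>x. INF w\<in>W. G x w)"
proof (rule ereal_convex_onI[OF assms(1)])
  fix x y r s u v
  assume xy: "x \<in> S" "y \<in> S" and r: "(INF w\<in>W. G x w) \<le> ereal r" and s: "(INF w\<in>W. G y w) \<le> ereal s"
    and uv: "0 \<le> u" "0 \<le> v" "u + v = (1::real)"
  show "(INF w\<in>W. G (u *\<^sub>R x + v *\<^sub>R y) w) \<le> ereal (u * r + v * s)"
  proof (rule ereal_le_epsilon2)
    fix e :: real assume e: "0 < e"
    have "(INF w\<in>W. G x w) < ereal (r + e)" "(INF w\<in>W. G y w) < ereal (s + e)"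
      using r s e by (auto intro: le_less_trans)
    then obtain a b where a: "a \<in> W" "G x a < ereal (r + e)" and b: "b \<in> W" "G y b < ereal (s + e)"
      by (auto simp: INF_less_iff)
    have "(\<lambda>(x, w). G x w) (u *\<^sub>R (x, a) + v *\<^sub>R (y, b)) \<le> ereal (u * (r + e) + v * (s + e))"
      using a b xy by (intro ereal_convex_onD[OF assms(3) _ _ _ _ uv]) auto
    moreover have "u *\<^sub>R a + v *\<^sub>R b \<in> W"
      using a b uv assms(2) by (auto intro: convexD)
    moreover have "u * (r + e) + v * (s + e) = u * r + v * s + (u + v) * e"
      by (simp add: algebra_simps)
    ultimately show "(INF w\<in>W. G (u *\<^sub>R x + v *\<^sub>R y) w) \<le> ereal (u * r + v * s) + ereal e"
      using uv by (auto intro!: INF_lower2[of "u *\<^sub>R a + v *\<^sub>R b"])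
  qed
qed

lemma lsc_onI_real:
  assumes "\<And>a::real. closedin (top_of_set S) {x \<in> S. f x \<le> ereal a}"
  shows "lsc_on S f"
  unfolding lsc_on_def
proof
  fix a
  show "closedin (top_of_set S) {x \<in> S. f x \<le> a}"
  proof (cases a)
    case MInf
    have "{x \<in> S. f x \<le> a} = (\<Inter>n::nat. {x \<in> S. f x \<le> ereal (- real n)})"
    proof (intro equalityI subsetI)
      fix x assume x: "x \<in> (\<Inter>n::nat. {x \<in> S. f x \<le> ereal (- real n)})"
      have "f x = -\<infinity>"
      proof (cases "f x")
        case (real r)
        obtain n where "- r < real n" using reals_Archimedean2 by blast
        moreover have "f x \<le> ereal (- real n)" using x by blast
        ultimately show ?thesis using real by auto
      next
        case PInf
        moreover have "f x \<le> ereal (- real 0)" using x by blast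
        ultimately show ?thesis by auto
      qed
      then show "x \<in> {x \<in> S. f x \<le> a}" using x by auto
    qed (auto simp: MInf)
    also have "closedin (top_of_set S) \<dots>"
      using assms by (intro closedin_INT) auto
    finally show ?thesis .
  qed (use assms in auto)
qed

lemma lsc_on_iff_openin:
  "lsc_on S f \<longleftrightarrow> (\<forall>a. openin (top_of_set S) {x \<in> S. a < f x})"
proof -
  have "{x \<in> S. f x \<le> a} = S - {x \<in> S. a < f x}" "{x \<in> S. a < f x} = S - {x \<in> S. f x \<le> a}" for a
    by auto
  then show ?thesis
    unfolding lsc_on_def
    by (metis (lifting) closedin_def mem_Collect_eq openin_closedin_eq subsetI topspace_euclidean_subtopology)
qed

text \<open>
  A sum exceeds \<open>a\<close> exactly if, for some split of \<open>a\<close> into \<open>q\<close> and \<open>a - q\<close>, each summand exceeds its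
  share; this writes the strict superlevel set as a union of open sets.
\<close>

lemma lsc_on_add:
  assumes "lsc_on S f" "lsc_on S g"
    and nonneg: "\<And>x. x \<in> S \<Longrightarrow> 0 \<le> f x" "\<And>x. x \<in> S \<Longrightarrow> 0 \<le> g x"
  shows "lsc_on S (\<lambda>x. f x + g x)"
proof (rule lsc_onI_real)
  fix a :: real
  have "{x \<in> S. ereal a < f x + g x} = (\<Union>q::real. {x \<in> S. ereal q < f x} \<inter> {x \<in> S. ereal (a - q) < g x})"
  proof (intro equalityI subsetI)
    fix x assume x: "x \<in> {x \<in> S. ereal a < f x + g x}"
    then have S: "x \<in> S" by simp
    have "\<exists>q::real. ereal q < f x \<and> ereal (a - q) < g x"
    proof (cases "f x")
      case (real c)
      show ?thesis
      proof (cases "g x")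
        case (real d)
        with \<open>f x = ereal c\<close> x have "a < c + d" by auto
        then show ?thesis
          by (intro exI[of _ "c - (c + d - a) / 2"]) (auto simp: real \<open>f x = ereal c\<close> field_simps)
      qed (use nonneg[OF S] real in \<open>auto intro: exI[of _ "c - 1"]\<close>)
    next
      case PInf
      show ?thesis using nonneg(2)[OF S] PInf
        by (intro exI[of _ "a + 1"]) (cases "g x"; auto)
    qed (use nonneg[OF S] in auto)
    then show "x \<in> (\<Union>q::real. {x \<in> S. ereal q < f x} \<inter> {x \<in> S. ereal (a - q) < g x})" using S by auto
  next
    fix x assume "x \<in> (\<Union>q::real. {x \<in> S. ereal q < f x} \<inter> {x \<in> S. ereal (a - q) < g x})"
    then obtain q where "x \<in> S" "ereal q < f x" "ereal (a - q) < g x" by auto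
    then show "x \<in> {x \<in> S. ereal a < f x + g x}"
      by (cases "f x"; cases "g x") auto
  qed
  moreover have "openin (top_of_set S) \<dots>"
    using assms(1,2) unfolding lsc_on_iff_openin by blast
  moreover have "{x \<in> S. f x + g x \<le> ereal a} = S - {x \<in> S. ereal a < f x + g x}" by auto
  ultimately show "closedin (top_of_set S) {x \<in> S. f x + g x \<le> ereal a}"
    by (metis (no_types, lifting) closedin_diff closedin_topspace topspace_euclidean_subtopology)
qed

lemma lsc_on_SUP:
  assumes "I \<noteq> {}" "\<And>i. i \<in> I \<Longrightarrow> lsc_on S (f i)"
  shows "lsc_on S (\<lambda>x. SUP i\<in>I. f i x)"
  unfolding lsc_on_def
proof
  fix a
  have "{x \<in> S. (SUP i\<in>I. f i x) \<le> a} = (\<Inter>i\<in>I. {x \<in> S. f i x \<le> a})"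
    using assms(1) by (auto simp: SUP_le_iff)
  then show "closedin (top_of_set S) {x \<in> S. (SUP i\<in>I. f i x) \<le> a}"
    using assms unfolding lsc_on_def by (auto intro!: closedin_INT)
qed

lemma lsc_on_max:
  assumes "lsc_on S f" "lsc_on S g"
  shows "lsc_on S (\<lambda>x. max (f x) (g x))"
  unfolding lsc_on_def
proof
  fix a
  have "{x \<in> S. max (f x) (g x) \<le> a} = {x \<in> S. f x \<le> a} \<inter> {x \<in> S. g x \<le> a}" by auto
  then show "closedin (top_of_set S) {x \<in> S. max (f x) (g x) \<le> a}"
    using assms unfolding lsc_on_def by (auto intro!: closedin_Int)
qed

lemma lsc_on_compose:
  assumes "lsc_on S f" "continuous_on T g" "g \<in> T \<rightarrow> S"
  shows "lsc_on T (\<lambda>x. f (g x))"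
  unfolding lsc_on_def
proof
  fix a
  have "{x \<in> T. f (g x) \<le> a} = T \<inter> g -` {x \<in> S. f x \<le> a}" using assms(3) by auto
  then show "closedin (top_of_set T) {x \<in> T. f (g x) \<le> a}"
    using continuous_closedin_preimage_gen[OF assms(2,3)] assms(1) unfolding lsc_on_def by metis
qed

lemma lsc_on_continuous:
  assumes "continuous_on S f"
  shows "lsc_on S (\<lambda>x. ereal (f x))"
proof (rule lsc_onI_real)
  fix a
  have "{x \<in> S. ereal (f x) \<le> ereal a} = S \<inter> f -` {..a}" by auto
  then show "closedin (top_of_set S) {x \<in> S. ereal (f x) \<le> ereal a}"
    using assms by (auto intro!: continuous_closedin_preimage)
qed

lemma closedin_fst_image:
  assumes "compact K" "closedin (top_of_set (S \<times> K)) C"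
  shows "closedin (top_of_set S) (fst ` C)"
proof -
  have "compact_space (top_of_set K)"
    using assms(1) by (simp add: compact_space_subtopology)
  then have "closed_map (prod_topology (top_of_set S) (top_of_set K)) (top_of_set S) fst"
    by (rule Abstract_Topological_Spaces.closed_map_fst)
  then show ?thesis
    using assms(2) by (simp add: closed_map_def)
qed

text \<open>
  At each level only the near-minimisers in a compact set matter, and there the sublevel set of the
  partial infimum is an intersection of projections of closed sets along a compact factor.
\<close>

lemma lsc_on_INF_coercive:
  assumes lsc: "lsc_on (S \<times> W) (\<lambda>(x, w). G x w)"
    and coercive: "\<And>a::real. \<exists>K\<subseteq>W. compact K \<and> (\<forall>x\<in>S. \<forall>w\<in>W. G x w < ereal a \<longrightarrow> w \<in> K)"
  shows "lsc_on S (\<lambda>x. INF w\<in>W. G x w)"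
proof (rule lsc_onI_real)
  fix a :: real
  obtain K where K: "K \<subseteq> W" "compact K" "\<And>x w. \<lbrakk>x \<in> S; w \<in> W; G x w < ereal (a + 2)\<rbrakk> \<Longrightarrow> w \<in> K"
    using coercive[of "a + 2"] by blast
  define C where "C n = {p \<in> S \<times> K. (case p of (x, w) \<Rightarrow> G x w) \<le> ereal (a + 1 / real (Suc n))}" for n
  have "{x \<in> S. (INF w\<in>W. G x w) \<le> ereal a} = (\<Inter>n. fst ` C n)"
  proof (intro equalityI subsetI)
    fix x assume x: "x \<in> {x \<in> S. (INF w\<in>W. G x w) \<le> ereal a}"
    show "x \<in> (\<Inter>n. fst ` C n)"
    proof
      fix n :: nat
      have "(INF w\<in>W. G x w) < ereal (a + 1 / real (Suc n))"
        using x by (auto intro: le_less_trans)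
      then obtain w where w: "w \<in> W" "G x w < ereal (a + 1 / real (Suc n))"
        by (auto simp: INF_less_iff)
      moreover have "ereal (a + 1 / real (Suc n)) < ereal (a + 2)"
        by (simp add: field_simps)
      ultimately have "G x w < ereal (a + 2)" by order
      then have "w \<in> K" using x w(1) K(3) by blast
      then show "x \<in> fst ` C n"
        using x w by (intro image_eqI[of _ _ "(x, w)"]) (auto simp: C_def)
    qed
  next
    fix x assume x: "x \<in> (\<Inter>n. fst ` C n)"
    then have "x \<in> fst ` C 0" by blast
    then have "x \<in> S" by (auto simp: C_def)
    moreover have "(INF w\<in>W. G x w) \<le> ereal a"
    proof (rule ereal_le_epsilon2)
      fix e :: real assume "0 < e"
      then obtain n where n: "1 / real (Suc n) < e"
        using nat_approx_posE by blast
      from x obtain w where "w \<in> K" "G x w \<le> ereal (a + 1 / real (Suc n))"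
        by (force simp: C_def)
      then have "(INF w\<in>W. G x w) \<le> ereal (a + 1 / real (Suc n))"
        using K(1) by (auto intro: INF_lower2)
      also have "\<dots> \<le> ereal a + ereal e" using n by simp
      finally show "(INF w\<in>W. G x w) \<le> ereal a + ereal e" .
    qed
    ultimately show "x \<in> {x \<in> S. (INF w\<in>W. G x w) \<le> ereal a}" by simp
  qed
  moreover have "closedin (top_of_set S) (fst ` C n)" for n
  proof (rule closedin_fst_image[OF K(2)])
    have "lsc_on (S \<times> K) (\<lambda>(x, w). G x w)"
      using lsc_on_compose[OF lsc continuous_on_id, of "S \<times> K"] K(1) by auto
    then show "closedin (top_of_set (S \<times> K)) (C n)"
      unfolding lsc_on_def C_def by blast
  qed
  ultimately show "closedin (top_of_set S) {x \<in> S. (INF w\<in>W. G x w) \<le> ereal a}"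
    by (auto intro!: closedin_INT)
qed

lemma lsc_on_borel_measurable:
  assumes "lsc_on S f"
  shows "f \<in> borel_measurable (restrict_space borel S)"
proof (rule borel_measurableI_le)
  fix a
  have "closedin (top_of_set S) {x \<in> S. f x \<le> a}" using assms by (simp add: lsc_on_def)
  then obtain C where "closed C" "{x \<in> S. f x \<le> a} = S \<inter> C"
    by (auto simp: closedin_closed)
  moreover have "{x \<in> space (restrict_space borel S). f x \<le> a} = {x \<in> S. f x \<le> a}"
    by (auto simp: space_restrict_space)
  ultimately show "{x \<in> space (restrict_space borel S). f x \<le> a} \<in> sets (restrict_space borel S)"
    by (auto simp: sets_restrict_space)
qed

lemma INF_add_real: "(INF w\<in>W. g w + ereal c) = (INF w\<in>W. g w) + ereal c"
proof (rule antisym)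
  have "(INF w\<in>W. g w + ereal c) + ereal (- c) \<le> (INF w\<in>W. g w)"
  proof (rule INF_greatest)
    fix w assume "w \<in> W"
    then have "(INF w\<in>W. g w + ereal c) + ereal (- c) \<le> (g w + ereal c) + ereal (- c)"
      by (intro add_right_mono INF_lower)
    also have "\<dots> = g w" by (cases "g w") auto
    finally show "(INF w\<in>W. g w + ereal c) + ereal (- c) \<le> g w" .
  qed
  then have "(INF w\<in>W. g w + ereal c) + ereal (- c) + ereal c \<le> (INF w\<in>W. g w) + ereal c"
    by (rule add_right_mono)
  then show "(INF w\<in>W. g w + ereal c) \<le> (INF w\<in>W. g w) + ereal c"
    by (cases "INF w\<in>W. g w + ereal c") auto
qed (intro INF_greatest add_right_mono INF_lower)

lemma add_real_mono_split: "a \<le> b + c \<Longrightarrow> k + ereal a \<le> k + ereal b + ereal c"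
  by (cases k) auto

lemma ereal_convex_on_real:
  assumes "convex_on S g"
  shows "ereal_convex_on S (\<lambda>x. ereal (g x))"
proof (rule ereal_convex_onI)
  show "convex S" using assms by (simp add: convex_on_def)
  fix x y r s u v
  assume *: "x \<in> S" "y \<in> S" "ereal (g x) \<le> ereal r" "ereal (g y) \<le> ereal s"
    "0 \<le> u" "0 \<le> v" "u + v = (1::real)"
  have "g (u *\<^sub>R x + v *\<^sub>R y) \<le> u * g x + v * g y"
    using assms * by (auto simp: convex_on_def)
  also have "\<dots> \<le> u * r + v * s" using * by (intro add_mono mult_left_mono) auto
  finally show "ereal (g (u *\<^sub>R x + v *\<^sub>R y)) \<le> ereal (u * r + v * s)" by simp
qed

lemma ereal_convex_on_ineq:
  assumes "ereal_convex_on S f" "x \<in> S" "y \<in> S" "0 \<le> u" "0 \<le> v" "u + v = (1::real)"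
    and nonneg: "\<And>x. x \<in> S \<Longrightarrow> 0 \<le> f x"
  shows "f (u *\<^sub>R x + v *\<^sub>R y) \<le> ereal u * f x + ereal v * f y"
proof -
  consider "u = 0" "v = 1" | "u = 1" "v = 0" | "0 < u" "0 < v"
    using assms(4-6) by (cases "u = 0"; cases "v = 0") auto
  then show ?thesis
  proof cases
    case 3
    show ?thesis
    proof (cases "f x = \<infinity> \<or> f y = \<infinity>")
      case True
      then have "ereal u * f x + ereal v * f y = \<infinity>"
        using 3 nonneg[OF assms(2)] nonneg[OF assms(3)] by (cases "f x"; cases "f y") auto
      then show ?thesis by (simp only: ereal_less_eq)
    next
      case False
      with nonneg[OF assms(2)] nonneg[OF assms(3)]
      obtain r s where "f x = ereal r" "f y = ereal s" by (cases "f x"; cases "f y") auto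
      then show ?thesis
        using ereal_convex_onD[OF assms(1-3), of r s u v] assms(4-6) by simp
    qed
  qed (auto simp: one_ereal_def[symmetric] zero_ereal_def[symmetric])
qed

lemma ereal_convex_on_ineqI:
  assumes "convex S"
    and ineq: "\<And>x y u v. \<lbrakk>x \<in> S; y \<in> S; 0 \<le> u; 0 \<le> v; u + v = (1::real)\<rbrakk>
           \<Longrightarrow> f (u *\<^sub>R x + v *\<^sub>R y) \<le> ereal u * f x + ereal v * f y"
  shows "ereal_convex_on S f"
proof (rule ereal_convex_onI[OF assms(1)])
  fix x y r s u v
  assume *: "x \<in> S" "y \<in> S" "f x \<le> ereal r" "f y \<le> ereal s" "0 \<le> u" "0 \<le> v" "u + v = (1::real)"
  have "f (u *\<^sub>R x + v *\<^sub>R y) \<le> ereal u * f x + ereal v * f y" using * by (intro ineq)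
  also have "\<dots> \<le> ereal u * ereal r + ereal v * ereal s"
    using * by (intro add_mono ereal_mult_left_mono) auto
  finally show "f (u *\<^sub>R x + v *\<^sub>R y) \<le> ereal (u * r + v * s)" by simp
qed

section \<open>Norms on coordinate subspaces\<close>

lemma lookup_scaleR [simp]:
  "Poly_Mapping.lookup (c *\<^sub>R x) i = c * Poly_Mapping.lookup (x :: vec) i"
proof -
  have "finite {i. c * Poly_Mapping.lookup x i \<noteq> 0}"
    by (rule finite_subset[of _ "Poly_Mapping.keys x"]) (auto simp: in_keys_iff)
  then show ?thesis
    by (simp add: scaleR_poly_mapping_def Abs_poly_mapping_inverse)
qed

lemma Rn_0 [simp]: "0 \<in> Rn d"
  and Rn_add: "x \<in> Rn d \<Longrightarrow> y \<in> Rn d \<Longrightarrow> x + y \<in> Rn d"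
  and Rn_diff: "x \<in> Rn d \<Longrightarrow> y \<in> Rn d \<Longrightarrow> x - y \<in> Rn d"
  and Rn_scaleR: "x \<in> Rn d \<Longrightarrow> c *\<^sub>R x \<in> Rn d"
  and Rn_mono: "d \<le> e \<Longrightarrow> Rn d \<subseteq> Rn e"
  and Rn_single: "i < d \<Longrightarrow> Poly_Mapping.single i r \<in> Rn d"
  by (auto simp: Rn_def lookup_add lookup_minus lookup_single when_def)

lemma convex_Rn: "convex (Rn d)"
  unfolding convex_def by (auto intro: Rn_add Rn_scaleR)

lemma dot_0 [simp]: "dot d l 0 = 0"
  and dot_add: "dot d l (x + y) = dot d l x + dot d l y"
  and dot_diff: "dot d l (x - y) = dot d l x - dot d l y"
  and dot_scaleR: "dot d l (c *\<^sub>R x) = c * dot d l x"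
  and dot_minus: "dot d l (- x) = - dot d l x"
  by (simp_all add: dot_def lookup_add lookup_minus algebra_simps sum.distrib sum_subtractf
      sum_distrib_left sum_negf)

text \<open>
  Parametrizing the coordinate subspace by functions makes Tychonoff's theorem and finite product
  measures available for it.
\<close>

definition vec_of :: "nat \<Rightarrow> (nat \<Rightarrow> real) \<Rightarrow> vec" where
  "vec_of d f = (\<Sum>i<d. f i *\<^sub>R Poly_Mapping.single i 1)"

lemma lookup_vec_of [simp]: "Poly_Mapping.lookup (vec_of d f) i = (if i < d then f i else 0)"
proof -
  have "Poly_Mapping.lookup (vec_of d f) i
      = (\<Sum>k<d. Poly_Mapping.lookup (f k *\<^sub>R Poly_Mapping.single k (1::real)) i)"
    unfolding vec_of_def by (induction d) (auto simp: lookup_add)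
  also have "\<dots> = (\<Sum>k<d. if k = i then f k else 0)"
    by (intro sum.cong) (auto simp: lookup_single when_def)
  finally show ?thesis by simp
qed

lemma vec_of_in_Rn [simp]: "vec_of d f \<in> Rn d"
  by (simp add: Rn_def)

lemma vec_of_lookup: "x \<in> Rn d \<Longrightarrow> vec_of d (Poly_Mapping.lookup x) = x"
  by (intro poly_mapping_eqI) (auto simp: Rn_def)

lemma continuous_on_vec_of: "continuous_on UNIV (vec_of d)"
  unfolding vec_of_def by (intro continuous_intros) auto

lemma norm_Rn:
  assumes "x \<in> Rn d"
  shows "norm x = (\<Sum>i<d. \<bar>Poly_Mapping.lookup x i\<bar>)"
proof -
  have "norm x = (\<Sum>i\<in>Poly_Mapping.keys x. \<bar>Poly_Mapping.lookup x i\<bar>)"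
    by (simp add: norm_poly_mapping_def dist_poly_mapping_def)
  also have "\<dots> = (\<Sum>i<d. \<bar>Poly_Mapping.lookup x i\<bar>)"
    using assms by (intro sum.mono_neutral_left) (auto simp: Rn_def in_keys_iff not_le[symmetric])
  finally show ?thesis .
qed

lemma abs_lookup_le_norm: "\<bar>Poly_Mapping.lookup (x :: vec) i\<bar> \<le> norm x"
proof (cases "i \<in> Poly_Mapping.keys x")
  case True
  then show ?thesis
    by (auto simp: norm_poly_mapping_def dist_poly_mapping_def intro: member_le_sum)
next
  case False
  then show ?thesis by (simp add: in_keys_iff)
qed

lemma continuous_on_lookup: "continuous_on S (\<lambda>x :: vec. Poly_Mapping.lookup x i)"
proof -
  have "\<bar>Poly_Mapping.lookup x i - Poly_Mapping.lookup y i\<bar> \<le> dist x y" for x y :: vec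
    using abs_lookup_le_norm[of "x - y" i] by (simp add: lookup_minus dist_norm)
  then show ?thesis
    by (intro lipschitz_on_continuous_on[of 1] lipschitz_onI) (auto simp: dist_real_def)
qed

lemma continuous_on_dot: "continuous_on S (dot d l)"
  unfolding dot_def by (intro continuous_intros continuous_on_lookup)

text \<open>
  The ball is the continuous image under \<^const>\<open>vec_of\<close> of a closed part of a cube, which is compact by
  Tychonoff's theorem.
\<close>

lemma compact_norm_ball_Rn: "compact {x \<in> Rn d. norm x \<le> r}"
proof -
  define B where "B = {x \<in> Rn d. norm x \<le> r}"
  have "B = vec_of d ` ({f. (\<forall>i. f i \<in> {- r..r})} \<inter> (\<lambda>f. norm (vec_of d f)) -` {..r})"
  proof (intro equalityI subsetI)
    fix x assume x: "x \<in> B"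
    then have "0 \<le> r" using norm_ge_zero[of x] unfolding B_def by (smt (verit) mem_Collect_eq)
    then have "x = vec_of d (Poly_Mapping.lookup x)" "\<bar>Poly_Mapping.lookup x i\<bar> \<le> r" for i
      using x abs_lookup_le_norm[of x i] by (auto simp: B_def vec_of_lookup)
    then show "x \<in> vec_of d ` ({f. (\<forall>i. f i \<in> {- r..r})} \<inter> (\<lambda>f. norm (vec_of d f)) -` {..r})"
      using x by (intro image_eqI[of _ _ "Poly_Mapping.lookup x"])
        (auto simp: B_def vec_of_lookup abs_le_iff minus_le_iff)
  qed (auto simp: B_def)
  moreover have "compact {f :: nat \<Rightarrow> real. (\<forall>i. f i \<in> {- r..r})}"
  proof -
    have "compactin (product_topology (\<lambda>i::nat. euclidean) UNIV) (PiE UNIV (\<lambda>i. {- r..r}))"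
      by (subst compactin_PiE) auto
    then have "compact (PiE UNIV (\<lambda>i::nat. {- r..r}))"
      by (simp add: euclidean_product_topology)
    moreover have "PiE UNIV (\<lambda>i::nat. {- r..r}) = {f. (\<forall>i. f i \<in> {- r..r})}"
      by (auto simp: PiE_def Pi_def)
    ultimately show ?thesis by simp
  qed
  moreover have "closed ((\<lambda>f. norm (vec_of d f)) -` {..r})"
    by (intro closed_vimage continuous_intros continuous_on_vec_of)
  ultimately show ?thesis
    unfolding B_def[symmetric]
    by (auto intro!: compact_continuous_image continuous_on_subset[OF continuous_on_vec_of] compact_Int_closed)
qed

context
  fixes d N
  assumes N: "is_norm d N"
begin

lemma is_norm_nonneg: "x \<in> Rn d \<Longrightarrow> 0 \<le> N x"
  and is_norm_eq_0: "x \<in> Rn d \<Longrightarrow> N x = 0 \<longleftrightarrow> x = 0"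
  and is_norm_scaleR: "x \<in> Rn d \<Longrightarrow> N (c *\<^sub>R x) = \<bar>c\<bar> * N x"
  and is_norm_triangle: "x \<in> Rn d \<Longrightarrow> y \<in> Rn d \<Longrightarrow> N (x + y) \<le> N x + N y"
  using N unfolding is_norm_def by auto

lemma is_norm_zero: "N 0 = 0"
  using is_norm_eq_0[of 0] by simp

lemma is_norm_minus_commute: "x \<in> Rn d \<Longrightarrow> y \<in> Rn d \<Longrightarrow> N (x - y) = N (y - x)"
  using is_norm_scaleR[of "x - y" "-1"] by (simp add: Rn_diff)

lemma is_norm_triangle_diff:
  assumes "x \<in> Rn d" "y \<in> Rn d" "z \<in> Rn d"
  shows "N (x - z) \<le> N (x - y) + N (y - z)"
  using is_norm_triangle[of "x - y" "y - z"] assms by (simp add: Rn_diff)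

lemma is_norm_vec_of_le: "k \<le> d \<Longrightarrow> N (vec_of k f) \<le> (\<Sum>i<k. \<bar>f i\<bar> * N (Poly_Mapping.single i 1))"
proof (induction k)
  case 0
  then show ?case by (simp add: vec_of_def is_norm_zero)
next
  case (Suc k)
  have "N (vec_of (Suc k) f) \<le> N (vec_of k f) + N (f k *\<^sub>R Poly_Mapping.single k 1)"
    using Suc.prems Rn_mono[of k d] unfolding vec_of_def sum.lessThan_Suc
    by (intro is_norm_triangle) (auto simp: vec_of_def[symmetric] intro!: Rn_scaleR Rn_single)
  also have "N (f k *\<^sub>R Poly_Mapping.single k 1) = \<bar>f k\<bar> * N (Poly_Mapping.single k 1)"
    using Suc.prems by (intro is_norm_scaleR Rn_single) auto
  finally show ?case using Suc by simp
qed

lemma is_norm_le_norm: "\<exists>C. 0 \<le> C \<and> (\<forall>x\<in>Rn d. N x \<le> C * norm x)"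
proof (intro exI[of _ "\<Sum>i<d. N (Poly_Mapping.single i 1)"] conjI ballI)
  show "0 \<le> (\<Sum>i<d. N (Poly_Mapping.single i 1))"
    by (intro sum_nonneg is_norm_nonneg Rn_single) auto
  fix x assume x: "x \<in> Rn d"
  have "N x \<le> (\<Sum>i<d. \<bar>Poly_Mapping.lookup x i\<bar> * N (Poly_Mapping.single i 1))"
    using is_norm_vec_of_le[of d "Poly_Mapping.lookup x"] x by (simp add: vec_of_lookup)
  also have "\<dots> \<le> (\<Sum>i<d. norm x * N (Poly_Mapping.single i 1))"
    by (intro sum_mono mult_right_mono abs_lookup_le_norm is_norm_nonneg Rn_single) auto
  finally show "N x \<le> (\<Sum>i<d. N (Poly_Mapping.single i 1)) * norm x"
    by (simp add: sum_distrib_left mult.commute)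
qed

lemma continuous_on_is_norm: "continuous_on (Rn d) N"
proof -
  obtain C where C: "0 \<le> C" "\<And>x. x \<in> Rn d \<Longrightarrow> N x \<le> C * norm x"
    using is_norm_le_norm by blast
  have "\<bar>N x - N y\<bar> \<le> C * dist x y" if "x \<in> Rn d" "y \<in> Rn d" for x y
    using is_norm_triangle[of "x - y" y] is_norm_triangle[of "y - x" x] C(2)[of "x - y"]
      is_norm_minus_commute[of x y] that by (simp add: Rn_diff dist_norm abs_le_iff)
  then show ?thesis
    using C(1) by (intro lipschitz_on_continuous_on[of C] lipschitz_onI) (auto simp: dist_real_def)
qed

text \<open>
  Equivalence of norms: \<open>N\<close> attains a positive minimum on the compact unit sphere of the ambient norm.
\<close>

lemma norm_le_is_norm: "\<exists>C>0. \<forall>x\<in>Rn d. norm x \<le> C * N x"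
proof (cases "Rn d = {0}")
  case True
  then show ?thesis by (intro exI[of _ 1]) (auto simp: is_norm_zero)
next
  case False
  define S where "S = {x \<in> Rn d. norm x \<le> 1} \<inter> norm -` {1}"
  have "compact S"
    unfolding S_def by (intro compact_Int_closed compact_norm_ball_Rn closed_vimage continuous_intros) 
  moreover have "S \<noteq> {}"
  proof -
    from False obtain x where "x \<in> Rn d" "x \<noteq> 0" using Rn_0 by blast
    then have "(1 / norm x) *\<^sub>R x \<in> S" by (auto simp: S_def intro: Rn_scaleR)
    then show ?thesis by auto
  qed
  moreover have "continuous_on S N"
    by (rule continuous_on_subset[OF continuous_on_is_norm]) (auto simp: S_def)
  ultimately obtain u where u: "u \<in> S" "\<And>x. x \<in> S \<Longrightarrow> N u \<le> N x"
    using continuous_attains_inf[of S N] by blast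
  have "0 < N u"
    using u(1) is_norm_nonneg[of u] is_norm_eq_0[of u] unfolding S_def by force
  moreover have "norm x \<le> 1 / N u * N x" if x: "x \<in> Rn d" for x
  proof (cases "x = 0")
    case False
    then have "(1 / norm x) *\<^sub>R x \<in> S" using x by (auto simp: S_def intro: Rn_scaleR)
    then have "N u \<le> 1 / norm x * N x" using u(2) is_norm_scaleR[OF x, of "1 / norm x"] by fastforce
    then show ?thesis using \<open>0 < N u\<close> False by (simp add: field_simps)
  qed (simp add: is_norm_zero)
  ultimately show ?thesis by (intro exI[of _ "1 / N u"]) auto
qed

lemma compact_is_norm_ball:
  assumes "c \<in> Rn d"
  shows "compact {x \<in> Rn d. N (x - c) \<le> r}"
proof -
  obtain C where C: "0 < C" "\<And>x. x \<in> Rn d \<Longrightarrow> norm x \<le> C * N x"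
    using norm_le_is_norm by blast
  define B where "B = {x \<in> Rn d. norm x \<le> C * r + norm c}"
  have cont: "continuous_on (Rn d) (\<lambda>x. N (x - c))"
    using assms by (intro continuous_on_compose2[OF continuous_on_is_norm] continuous_intros) (auto intro: Rn_diff)
  have "{x \<in> Rn d. N (x - c) \<le> r} = {x \<in> B. N (x - c) \<le> r}"
  proof -
    have "norm x \<le> C * r + norm c" if "x \<in> Rn d" "N (x - c) \<le> r" for x
    proof -
      have "norm x \<le> norm (x - c) + norm c" using norm_triangle_sub[of x c] by (simp add: add.commute)
      also have "norm (x - c) \<le> C * N (x - c)" using that assms by (intro C) (auto intro: Rn_diff)
      also have "\<dots> \<le> C * r" using that C by (intro mult_left_mono) auto
      finally show ?thesis by simp
    qed
    then show ?thesis by (auto simp: B_def)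
  qed
  also have "\<dots> = B \<inter> (\<lambda>x. N (x - c)) -` {..r}" by auto
  also have "compact \<dots>"
  proof (rule closedin_compact)
    show "compact B" unfolding B_def by (rule compact_norm_ball_Rn)
    show "closedin (top_of_set B) (B \<inter> (\<lambda>x. N (x - c)) -` {..r})"
      by (intro continuous_closedin_preimage continuous_on_subset[OF cont]) (auto simp: B_def)
  qed
  finally show ?thesis .
qed

lemma dual_norm_leI:
  assumes "\<And>u. u \<in> Rn d \<Longrightarrow> dot d l u \<le> M * N u" "0 \<le> M"
  shows "dual_norm d N l \<le> M"
  unfolding dual_norm_def
proof (rule cSUP_least)
  show "{x \<in> Rn d. N x \<le> 1} \<noteq> {}" using is_norm_zero by (intro ex_in_conv[THEN iffD1] exI[of _ 0]) simp
next
  fix u assume "u \<in> {x \<in> Rn d. N x \<le> 1}"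
  then show "dot d l u \<le> M"
    using assms(1)[of u] mult_left_mono[of "N u" 1 M] assms(2) by auto
qed

text \<open>
  The supremum that defines the dual norm is a real one, so it bounds its members only because the unit
  ball is bounded.
\<close>

lemma dot_le_dual_norm:
  assumes u: "u \<in> Rn d" and l: "dual_norm d N l \<le> M"
  shows "dot d l u \<le> M * N u"
proof (cases "u = 0")
  case False
  have "bdd_above (dot d l ` {x \<in> Rn d. N x \<le> 1})"
    using compact_is_norm_ball[of 0 1]
    by (intro bounded_imp_bdd_above compact_imp_bounded compact_continuous_image continuous_on_dot) simp
  moreover have pos: "0 < N u" using False u is_norm_eq_0 is_norm_nonneg by (metis less_eq_real_def)
  moreover have "(1 / N u) *\<^sub>R u \<in> {x \<in> Rn d. N x \<le> 1}"
    using u pos by (auto simp: is_norm_scaleR intro: Rn_scaleR)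
  ultimately have "dot d l ((1 / N u) *\<^sub>R u) \<le> dual_norm d N l"
    unfolding dual_norm_def by (intro cSUP_upper)
  then have "dot d l u / N u \<le> M" using l by (simp add: dot_scaleR)
  then show ?thesis using pos by (simp add: field_simps)
qed (simp add: is_norm_zero)

end

lemma convex_on_is_norm:
  assumes N: "is_norm d N" and "0 \<le> M"
  shows "convex_on (Rn d) (\<lambda>x. M * N x)"
proof (rule convex_onI)
  fix t x y assume t: "0 < t" "t < (1::real)" and xy: "x \<in> Rn d" "y \<in> Rn d"
  have "N ((1 - t) *\<^sub>R x + t *\<^sub>R y) \<le> (1 - t) * N x + t * N y"
    using is_norm_triangle[OF N, of "(1 - t) *\<^sub>R x" "t *\<^sub>R y"] t xy
    by (simp add: Rn_scaleR is_norm_scaleR[OF N])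
  then have "M * N ((1 - t) *\<^sub>R x + t *\<^sub>R y) \<le> M * ((1 - t) * N x + t * N y)"
    using assms(2) by (rule mult_left_mono)
  then show "M * N ((1 - t) *\<^sub>R x + t *\<^sub>R y) \<le> (1 - t) * (M * N x) + t * (M * N y)"
    by (simp add: algebra_simps)
qed (rule convex_Rn)

section \<open>Subgradients\<close>

lemma dot_Suc: "dot (Suc k) l x = dot k l x + Poly_Mapping.lookup l k * Poly_Mapping.lookup x k"
  by (simp add: dot_def)

text \<open>
  The extension step of the Hahn-Banach theorem.  A slope \<open>\<alpha>\<close> in the new direction \<open>e\<close> is admissible
  if it lies above all difference quotients to the left and below all those to the right; convexity
  separates these two families, because every segment from \<open>x + w' - s' e\<close> to \<open>x + w + s e\<close> meets
  \<open>x\<close> plus the old subspace.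
\<close>

lemma subgradient_extend:
  fixes h :: "'a::real_vector \<Rightarrow> real" and p :: "'a \<Rightarrow> real"
  assumes W: "subspace W" and p: "\<And>w z. w \<in> W \<Longrightarrow> z \<in> W \<Longrightarrow> p (w + z) = p w + p z"
      "\<And>w c. w \<in> W \<Longrightarrow> p (c *\<^sub>R w) = c * p w"
    and sub: "\<And>w. w \<in> W \<Longrightarrow> h x + p w \<le> h (x + w)"
    and conv: "\<And>w z s t u v. \<lbrakk>w \<in> W; z \<in> W; 0 \<le> u; 0 \<le> v; u + v = 1\<rbrakk> \<Longrightarrow>
       h (u *\<^sub>R (x + w + s *\<^sub>R e) + v *\<^sub>R (x + z + t *\<^sub>R e)) \<le> u * h (x + w + s *\<^sub>R e) + v * h (x + z + t *\<^sub>R e)"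
  shows "\<exists>\<alpha>. \<forall>w\<in>W. \<forall>s. h x + p w + s * \<alpha> \<le> h (x + w + s *\<^sub>R e)"
proof -
  define left where "left = (\<lambda>(z, t). (h x + p z - h (x + z - t *\<^sub>R e)) / t)"
  define right where "right = (\<lambda>(w, s). (h (x + w + s *\<^sub>R e) - h x - p w) / s)"
  have sep: "left (z, t) \<le> right (w, s)" if z: "z \<in> W" "0 < t" and w: "w \<in> W" "0 < s" for z t w s
  proof -
    \<comment> \<open>These weights make the two components along \<open>e\<close> cancel.\<close>
    define u where "u = t / (s + t)"
    define v where "v = s / (s + t)"
    have uv: "0 \<le> u" "0 \<le> v" "u + v = 1" "u * s = v * t"
      using z w by (auto simp: u_def v_def add_divide_distrib[symmetric])
    have mix: "u *\<^sub>R w + v *\<^sub>R z \<in> W"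
      using W z w by (intro subspace_add subspace_scale)
    have "u *\<^sub>R (x + w + s *\<^sub>R e) + v *\<^sub>R (x + z - t *\<^sub>R e)
        = (u + v) *\<^sub>R x + (u *\<^sub>R w + v *\<^sub>R z) + (u * s - v * t) *\<^sub>R e"
      by (simp add: algebra_simps)
    also have "\<dots> = x + (u *\<^sub>R w + v *\<^sub>R z)" using uv by simp
    finally have eq: "u *\<^sub>R (x + w + s *\<^sub>R e) + v *\<^sub>R (x + z - t *\<^sub>R e) = x + (u *\<^sub>R w + v *\<^sub>R z)" .
    have "h x + (u * p w + v * p z) \<le> h (x + (u *\<^sub>R w + v *\<^sub>R z))"
      using sub[OF mix] z w by (simp add: p W subspace_scale)
    also have "\<dots> \<le> u * h (x + w + s *\<^sub>R e) + v * h (x + z - t *\<^sub>R e)"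
      using conv[of w z u v s "- t"] w z uv eq by simp
    finally have "(s + t) * (h x + (u * p w + v * p z))
        \<le> (s + t) * (u * h (x + w + s *\<^sub>R e) + v * h (x + z - t *\<^sub>R e))"
      using z w by (intro mult_left_mono) auto
    moreover have "(s + t) * u = t" "(s + t) * v = s" using z w by (auto simp: u_def v_def)
    ultimately have "(s + t) * h x + t * p w + s * p z
        \<le> t * h (x + w + s *\<^sub>R e) + s * h (x + z - t *\<^sub>R e)"
      by (simp add: distrib_left mult.assoc[symmetric])
    then show ?thesis
      using z w by (simp add: left_def right_def field_simps)
  qed
  have 0: "0 \<in> W" using W by (rule subspace_0)
  define L where "L = left ` (W \<times> {0<..})"
  define \<alpha> where "\<alpha> = Sup L"
  have le: "left (z, t) \<le> \<alpha>" if "z \<in> W" "0 < t" for z t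
    unfolding \<alpha>_def L_def
    using that sep[OF _ _ 0, of _ _ 1]
    by (intro cSUP_upper bdd_aboveI2[of _ _ "right (0, 1)"]) auto
  have ge: "\<alpha> \<le> right (w, s)" if "w \<in> W" "0 < s" for w s
    unfolding \<alpha>_def L_def
    using that 0 sep by (intro cSUP_least) (auto intro: exI[of _ 1])
  have "h x + p w + s * \<alpha> \<le> h (x + w + s *\<^sub>R e)" if w: "w \<in> W" for w s
  proof -
    consider "s = 0" | "s > 0" | "s < 0" by linarith
    then show ?thesis
    proof cases
      case 1
      then show ?thesis using sub w by simp
    next
      case 2
      then show ?thesis using ge[OF w 2] by (simp add: right_def field_simps)
    next
      case 3
      then show ?thesis using le[OF w, of "- s"] by (simp add: left_def field_simps)
    qed
  qed
  then show ?thesis by blast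
qed

lemma subspace_Rn: "subspace (Rn k)"
  by (simp add: subspace_def Rn_add Rn_scaleR)

lemma Rn_SucE:
  assumes "z \<in> Rn (Suc k)"
  obtains w where "w \<in> Rn k" "z = w + Poly_Mapping.lookup z k *\<^sub>R Poly_Mapping.single k 1"
proof
  show "z - Poly_Mapping.lookup z k *\<^sub>R Poly_Mapping.single k 1 \<in> Rn k"
    using assms by (auto simp: Rn_def lookup_minus lookup_single when_def not_less_eq_eq le_Suc_eq)
qed simp

text \<open>
  The linear part of the supporting affine function is extended one coordinate at a time, from the trivial subspace to all of \<open>Rn d\<close>.
\<close>

lemma subgradient_exists:
  assumes h: "convex_on (Rn d) h" and x: "x \<in> Rn d"
  obtains l where "l \<in> Rn d" "\<And>z. z \<in> Rn d \<Longrightarrow> h x + dot d l (z - x) \<le> h z"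
proof -
  have "\<exists>l\<in>Rn k. \<forall>w\<in>Rn k. h x + dot k l w \<le> h (x + w)" if "k \<le> d" for k
    using that
  proof (induction k)
    case 0
    have "Rn 0 = {0}" by (auto simp: Rn_def intro: poly_mapping_eqI)
    then show ?case by (intro bexI[of _ 0]) (auto simp: dot_def)
  next
    case (Suc k)
    then obtain l where l: "l \<in> Rn k" "\<And>w. w \<in> Rn k \<Longrightarrow> h x + dot k l w \<le> h (x + w)" by auto
    define e where "e = (Poly_Mapping.single k 1 :: vec)"
    have mem: "x + w + s *\<^sub>R e \<in> Rn d" if "w \<in> Rn k" for w s
      using that Suc.prems x Rn_mono[of k d] unfolding e_def
      by (intro Rn_add Rn_scaleR Rn_single) auto
    have "\<exists>\<alpha>. \<forall>w\<in>Rn k. \<forall>s. h x + dot k l w + s * \<alpha> \<le> h (x + w + s *\<^sub>R e)"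
      using l(2) mem h by (intro subgradient_extend subspace_Rn) (auto simp: dot_add dot_scaleR convex_on_def)
    then obtain \<alpha> where \<alpha>: "\<And>w s. w \<in> Rn k \<Longrightarrow> h x + dot k l w + s * \<alpha> \<le> h (x + w + s *\<^sub>R e)" by blast
    have dot_l: "dot k (l + \<alpha> *\<^sub>R e) z = dot k l z" for z
      by (auto simp: dot_def e_def lookup_add lookup_single when_def intro!: sum.cong)
    show ?case
    proof (intro bexI ballI)
      show "l + \<alpha> *\<^sub>R e \<in> Rn (Suc k)"
        using l(1) Rn_mono[of k "Suc k"] unfolding e_def by (intro Rn_add Rn_scaleR Rn_single) auto
      fix z assume z: "z \<in> Rn (Suc k)"
      obtain w where w: "w \<in> Rn k" "z = w + Poly_Mapping.lookup z k *\<^sub>R e"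
        using Rn_SucE[OF z] unfolding e_def by metis
      have "dot k l z = dot k l w"
        by (subst w(2)) (simp add: dot_add dot_scaleR, simp add: dot_def e_def lookup_single when_def)
      moreover have lookup_e: "Poly_Mapping.lookup e k = 1" by (simp add: e_def)
      moreover have "Poly_Mapping.lookup l k = 0" using l(1) by (simp add: Rn_def)
      ultimately have "dot (Suc k) (l + \<alpha> *\<^sub>R e) z = dot k l w + Poly_Mapping.lookup z k * \<alpha>"
        by (simp add: dot_Suc dot_l lookup_add lookup_e mult.commute)
      then show "h x + dot (Suc k) (l + \<alpha> *\<^sub>R e) z \<le> h (x + z)"
        using \<alpha>[OF w(1), of "Poly_Mapping.lookup z k"] w(2) by (simp add: add.assoc)
    qed
  qed
  from this[of d] obtain l where l: "l \<in> Rn d" "\<And>w. w \<in> Rn d \<Longrightarrow> h x + dot d l w \<le> h (x + w)"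
    by auto
  show thesis
  proof (rule that[OF l(1)])
    fix z assume "z \<in> Rn d"
    then show "h x + dot d l (z - x) \<le> h z" using l(2)[of "z - x"] x by (simp add: Rn_diff)
  qed
qed

section \<open>Convex Lipschitz functions with extended values\<close>

text \<open>
  The terms of a conjugate: as a function of \<open>x\<close>, the infimum is a single affine function, with a
  constant term that may be infinite.
\<close>

lemma INF_affine_eq:
  "(INF z\<in>Rn d. m z + ereal (dot d l (x - z))) = (INF z\<in>Rn d. m z + ereal (dot d l (- z))) + ereal (dot d l x)"
  unfolding INF_add_real[symmetric]
proof (intro INF_cong refl)
  fix z
  show "m z + ereal (dot d l (x - z)) = m z + ereal (dot d l (- z)) + ereal (dot d l x)"
    by (cases "m z") (auto simp: dot_diff dot_minus)
qed

lemma lsc_on_INF_affine: "lsc_on S (\<lambda>x. INF z\<in>Rn d. m z + ereal (dot d l (x - z)))"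
proof (rule lsc_onI_real)
  fix a :: real
  define c where "c = (INF z\<in>Rn d. m z + ereal (dot d l (- z)))"
  have "closedin (top_of_set S) {x \<in> S. c + ereal (dot d l x) \<le> ereal a}"
  proof (cases c)
    case (real r)
    then have "{x \<in> S. c + ereal (dot d l x) \<le> ereal a} = S \<inter> dot d l -` {..a - r}" by auto
    then show ?thesis by (auto intro: continuous_closedin_preimage continuous_on_dot)
  qed auto
  then show "closedin (top_of_set S) {x \<in> S. (INF z\<in>Rn d. m z + ereal (dot d l (x - z))) \<le> ereal a}"
    by (simp only: INF_affine_eq c_def)
qed

lemma ereal_convex_on_INF_affine:
  assumes "convex S"
  shows "ereal_convex_on S (\<lambda>x. INF z\<in>Rn d. m z + ereal (dot d l (x - z)))"
proof (rule ereal_convex_onI[OF assms])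
  define c where "c = (INF z\<in>Rn d. m z + ereal (dot d l (- z)))"
  fix x y r s u v
  assume "(INF z\<in>Rn d. m z + ereal (dot d l (x - z))) \<le> ereal r"
    "(INF z\<in>Rn d. m z + ereal (dot d l (y - z))) \<le> ereal s"
  then have rs: "c + ereal (dot d l x) \<le> ereal r" "c + ereal (dot d l y) \<le> ereal s"
    by (simp_all only: INF_affine_eq c_def)
  assume uv: "0 \<le> u" "0 \<le> v" "u + v = (1::real)"
  have "c + ereal (dot d l (u *\<^sub>R x + v *\<^sub>R y)) \<le> ereal (u * r + v * s)"
  proof (cases c)
    case (real k)
    \<comment> \<open>The weights sum to 1, so the constant term splits like the linear part.\<close>
    have "k + dot d l (u *\<^sub>R x + v *\<^sub>R y) = u * (k + dot d l x) + v * (k + dot d l y)"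
      using uv(3) by (simp add: dot_add dot_scaleR algebra_simps flip: distrib_left)
    also have "\<dots> \<le> u * r + v * s" using rs uv real by (intro add_mono mult_left_mono) auto
    finally show ?thesis using real by simp
  qed (use rs in auto)
  then show "(INF z\<in>Rn d. m z + ereal (dot d l (u *\<^sub>R x + v *\<^sub>R y - z))) \<le> ereal (u * r + v * s)"
    by (simp only: INF_affine_eq c_def)
qed

text \<open>
  The value \<open>\<infinity>\<close> is admitted, since the expectations that define the cost-to-go functions may diverge.
  The Lipschitz condition has no absolute value, which would be meaningless for infinite values; it is
  symmetric in \<open>x\<close> and \<open>y\<close> anyway.
\<close>

definition lipschitz_convex :: "nat \<Rightarrow> (vec \<Rightarrow> real) \<Rightarrow> real \<Rightarrow> (vec \<Rightarrow> ereal) \<Rightarrow> bool" where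
  "lipschitz_convex d N M Q \<longleftrightarrow>
     (\<forall>x\<in>Rn d. 0 \<le> Q x) \<and> ereal_convex_on (Rn d) Q \<and>
     (\<forall>x\<in>Rn d. \<forall>y\<in>Rn d. Q x \<le> Q y + ereal (M * N (x - y)))"

lemma lipschitz_convexD:
  assumes "lipschitz_convex d N M Q"
  shows "x \<in> Rn d \<Longrightarrow> 0 \<le> Q x" "ereal_convex_on (Rn d) Q"
    "x \<in> Rn d \<Longrightarrow> y \<in> Rn d \<Longrightarrow> Q x \<le> Q y + ereal (M * N (x - y))"
  using assms by (auto simp: lipschitz_convex_def)

text \<open>
  A finite convex function is supported by an affine one at every point; the Lipschitz constant bounds
  the dual norm of the slope.  If the function takes the value \<open>\<infinity>\<close> anywhere, the Lipschitz condition
  makes it identically \<open>\<infinity>\<close>.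
\<close>

lemma lipschitz_convex_le_biconjugate:
  assumes N: "is_norm d N" and M: "0 \<le> M" and Q: "lipschitz_convex d N M Q" and x: "x \<in> Rn d"
  shows "Q x \<le> (SUP l\<in>{l \<in> Rn d. dual_norm d N l \<le> M}. INF z\<in>Rn d. Q z + ereal (dot d l (x - z)))"
proof (cases "Q x = \<infinity>")
  case True
  have "Q z = \<infinity>" if "z \<in> Rn d" for z
    using lipschitz_convexD(3)[OF Q x that] True by auto
  then have "(INF z\<in>Rn d. Q z + ereal (dot d 0 (x - z))) = \<infinity>"
    by (intro antisym INF_greatest) auto
  moreover have "0 \<in> {l \<in> Rn d. dual_norm d N l \<le> M}"
    using M is_norm_nonneg[OF N] by (auto intro!: dual_norm_leI[OF N] simp: dot_def)
  ultimately show ?thesis by (intro SUP_upper2) auto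
next
  case False
  define h where "h = (\<lambda>z. real_of_ereal (Q z))"
  have h: "Q z = ereal (h z)" if "z \<in> Rn d" for z
    using lipschitz_convexD(3)[OF Q that x] lipschitz_convexD(1)[OF Q] that x False
    unfolding h_def by (cases "Q z"; cases "Q x") force+
  have lip: "h z \<le> h y + M * N (z - y)" if "z \<in> Rn d" "y \<in> Rn d" for z y
    using lipschitz_convexD(3)[OF Q that] that by (simp add: h)
  have "convex_on (Rn d) h"
  proof (rule convex_onI)
    fix t y z assume t: "0 < t" "t < (1::real)" and yz: "y \<in> Rn d" "z \<in> Rn d"
    then show "h ((1 - t) *\<^sub>R y + t *\<^sub>R z) \<le> (1 - t) * h y + t * h z"
      using ereal_convex_onD[OF lipschitz_convexD(2)[OF Q] yz, of "h y" "h z" "1 - t" t]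
      by (simp add: h Rn_add Rn_scaleR)
  qed (rule convex_Rn)
  then obtain l where l: "l \<in> Rn d" "\<And>z. z \<in> Rn d \<Longrightarrow> h x + dot d l (z - x) \<le> h z"
    using subgradient_exists x by blast
  have "dual_norm d N l \<le> M"
  proof (rule dual_norm_leI[OF N _ M])
    fix u assume u: "u \<in> Rn d"
    then show "dot d l u \<le> M * N u"
      using l(2)[of "x + u"] lip[of "x + u" x] x by (simp add: Rn_add)
  qed
  moreover have "Q x \<le> (INF z\<in>Rn d. Q z + ereal (dot d l (x - z)))"
  proof (rule INF_greatest)
    fix z assume z: "z \<in> Rn d"
    then show "Q x \<le> Q z + ereal (dot d l (x - z))"
      using l(2)[OF z] x by (simp add: h dot_diff)
  qed
  ultimately show ?thesis using l(1) by (intro SUP_upper2[of l]) auto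
qed

text \<open>
  Such a function is a supremum of affine ones.
\<close>

lemma lipschitz_convex_lsc:
  assumes N: "is_norm d N" and M: "0 \<le> M" and Q: "lipschitz_convex d N M Q"
  shows "lsc_on (Rn d) Q"
proof -
  let ?B = "\<lambda>x. SUP l\<in>{l \<in> Rn d. dual_norm d N l \<le> M}. INF z\<in>Rn d. Q z + ereal (dot d l (x - z))"
  have "Q x = ?B x" if "x \<in> Rn d" for x
  proof (rule antisym)
    show "?B x \<le> Q x" using that by (intro SUP_least INF_lower2[of x]) auto
  qed (rule lipschitz_convex_le_biconjugate[OF N M Q that])
  then have "{x \<in> Rn d. Q x \<le> a} = {x \<in> Rn d. ?B x \<le> a}" for a by auto
  moreover have "lsc_on (Rn d) ?B"
  proof (rule lsc_on_SUP[OF _ lsc_on_INF_affine])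
    have "0 \<in> {l \<in> Rn d. dual_norm d N l \<le> M}"
      using M is_norm_nonneg[OF N] by (auto intro!: dual_norm_leI[OF N] simp: dot_def)
    then show "{l \<in> Rn d. dual_norm d N l \<le> M} \<noteq> {}" by blast
  qed
  ultimately show ?thesis by (simp add: lsc_on_def)
qed

lemma lipschitz_convex_SUP:
  assumes "I \<noteq> {}" "\<And>i. i \<in> I \<Longrightarrow> lipschitz_convex d N M (Q i)"
  shows "lipschitz_convex d N M (\<lambda>x. SUP i\<in>I. Q i x)"
  unfolding lipschitz_convex_def
proof (intro conjI ballI)
  fix x assume x: "x \<in> Rn d"
  from assms(1) obtain i where "i \<in> I" by blast
  then show "0 \<le> (SUP i\<in>I. Q i x)"
    using lipschitz_convexD(1)[OF assms(2) x] by (intro SUP_upper2)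
  fix y assume y: "y \<in> Rn d"
  show "(SUP i\<in>I. Q i x) \<le> (SUP i\<in>I. Q i y) + ereal (M * N (x - y))"
  proof (rule SUP_least)
    fix i assume i: "i \<in> I"
    have "Q i x \<le> Q i y + ereal (M * N (x - y))" by (rule lipschitz_convexD(3)[OF assms(2)[OF i] x y])
    also have "\<dots> \<le> (SUP i\<in>I. Q i y) + ereal (M * N (x - y))"
      using i by (intro add_right_mono SUP_upper)
    finally show "Q i x \<le> (SUP i\<in>I. Q i y) + ereal (M * N (x - y))" .
  qed
qed (intro ereal_convex_on_SUP convex_Rn lipschitz_convexD(2)[OF assms(2)])

text \<open>
  Lower semicontinuity in \<open>\<xi>\<close> supplies measurability.  Without it the nonnegative integral is only a
  lower integral, which is superadditive, and the expectation could fail to be convex.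
\<close>

lemma lipschitz_convex_expectation:
  assumes N: "is_norm d N" and M: "0 \<le> M"
    and p: "prob_space p" "sets p = sets (restrict_space borel \<Xi>)"
    and H: "\<And>\<xi>. \<xi> \<in> \<Xi> \<Longrightarrow> lipschitz_convex d N M (\<lambda>x. H x \<xi>)"
    and H_lsc: "\<And>x. x \<in> Rn d \<Longrightarrow> lsc_on \<Xi> (H x)"
  shows "lipschitz_convex d N M (\<lambda>x. enn2ereal (\<integral>\<^sup>+ \<xi>. e2ennreal (H x \<xi>) \<partial>p))"
proof -
  have space_p: "space p = \<Xi>"
    using sets_eq_imp_space_eq[OF p(2)] by (simp add: space_restrict_space)
  have meas: "(\<lambda>\<xi>. e2ennreal (H x \<xi>)) \<in> borel_measurable p" if "x \<in> Rn d" for x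
  proof -
    have "H x \<in> borel_measurable p"
      using lsc_on_borel_measurable[OF H_lsc[OF that]] by (simp add: measurable_cong_sets[OF p(2) refl])
    then show ?thesis by (rule measurable_compose[OF _ measurable_e2ennreal])
  qed
  have rep: "enn2ereal (e2ennreal (H x \<xi>)) = H x \<xi>" if "x \<in> Rn d" "\<xi> \<in> \<Xi>" for x \<xi>
    using lipschitz_convexD(1)[OF H[OF that(2)] that(1)] by (rule enn2ereal_e2ennreal)
  have rep_ennreal: "enn2ereal (ennreal c) = ereal c" if "0 \<le> c" for c
    using that by (simp add: enn2ereal_ennreal)
  show ?thesis
    unfolding lipschitz_convex_def
  proof (intro conjI ballI ereal_convex_on_ineqI convex_Rn)
    fix x y assume xy: "x \<in> Rn d" "y \<in> Rn d"
    define c where "c = M * N (x - y)"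
    have c: "0 \<le> c" using M is_norm_nonneg[OF N] xy by (simp add: c_def Rn_diff)
    have "e2ennreal (H x \<xi>) \<le> e2ennreal (H y \<xi>) + ennreal c" if "\<xi> \<in> \<Xi>" for \<xi>
      unfolding less_eq_ennreal.rep_eq plus_ennreal.rep_eq
      using lipschitz_convexD(3)[OF H[OF that] xy] that xy c by (simp add: rep rep_ennreal c_def)
    then have "(\<integral>\<^sup>+ \<xi>. e2ennreal (H x \<xi>) \<partial>p) \<le> (\<integral>\<^sup>+ \<xi>. e2ennreal (H y \<xi>) + ennreal c \<partial>p)"
      by (intro nn_integral_mono) (simp add: space_p)
    also have "\<dots> = (\<integral>\<^sup>+ \<xi>. e2ennreal (H y \<xi>) \<partial>p) + ennreal c"
      using xy by (simp add: nn_integral_add meas prob_space.emeasure_space_1[OF p(1)])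
    finally show "enn2ereal (\<integral>\<^sup>+ \<xi>. e2ennreal (H x \<xi>) \<partial>p)
        \<le> enn2ereal (\<integral>\<^sup>+ \<xi>. e2ennreal (H y \<xi>) \<partial>p) + ereal (M * N (x - y))"
      unfolding less_eq_ennreal.rep_eq plus_ennreal.rep_eq using c by (simp add: rep_ennreal c_def)
  next
    fix x y u v assume xy: "x \<in> Rn d" "y \<in> Rn d" and uv: "0 \<le> u" "0 \<le> v" "u + v = (1::real)"
    let ?w = "u *\<^sub>R x + v *\<^sub>R y"
    have w: "?w \<in> Rn d" using xy by (intro Rn_add Rn_scaleR)
    have "e2ennreal (H ?w \<xi>) \<le> ennreal u * e2ennreal (H x \<xi>) + ennreal v * e2ennreal (H y \<xi>)"
      if \<xi>: "\<xi> \<in> \<Xi>" for \<xi>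
      unfolding less_eq_ennreal.rep_eq plus_ennreal.rep_eq times_ennreal.rep_eq
      using ereal_convex_on_ineq[OF lipschitz_convexD(2)[OF H[OF \<xi>]] xy uv lipschitz_convexD(1)[OF H[OF \<xi>]]]
        \<xi> xy uv w by (simp add: rep rep_ennreal)
    then have "(\<integral>\<^sup>+ \<xi>. e2ennreal (H ?w \<xi>) \<partial>p)
        \<le> (\<integral>\<^sup>+ \<xi>. ennreal u * e2ennreal (H x \<xi>) + ennreal v * e2ennreal (H y \<xi>) \<partial>p)"
      by (intro nn_integral_mono) (simp add: space_p)
    also have "\<dots> = ennreal u * (\<integral>\<^sup>+ \<xi>. e2ennreal (H x \<xi>) \<partial>p) + ennreal v * (\<integral>\<^sup>+ \<xi>. e2ennreal (H y \<xi>) \<partial>p)"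
      using xy meas by (subst nn_integral_add) (auto simp: nn_integral_cmult)
    finally show "enn2ereal (\<integral>\<^sup>+ \<xi>. e2ennreal (H ?w \<xi>) \<partial>p)
        \<le> ereal u * enn2ereal (\<integral>\<^sup>+ \<xi>. e2ennreal (H x \<xi>) \<partial>p)
          + ereal v * enn2ereal (\<integral>\<^sup>+ \<xi>. e2ennreal (H y \<xi>) \<partial>p)"
      unfolding less_eq_ennreal.rep_eq plus_ennreal.rep_eq times_ennreal.rep_eq
      using uv by (simp add: rep_ennreal)
  qed simp_all
qed

section \<open>The regularized stage value as an infimal convolution\<close>

text \<open>
  One stage of the recursion: \<open>d\<close> and \<open>e\<close> are the dimensions before and after the transition, and \<open>Q\<close>
  is the cost-to-go function after it.
\<close>

locale stage_data =
  fixes d e :: nat and N :: "vec \<Rightarrow> real" and M :: real and X :: "vec set" and \<Xi> :: "vec set"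
    and f :: "vec \<Rightarrow> vec \<Rightarrow> vec \<Rightarrow> ereal" and Q :: "vec \<Rightarrow> ereal"
  assumes N: "is_norm d N" and M: "0 < M"
    and X: "X \<subseteq> Rn e" "compact X" "convex X"
    and f_nonneg: "\<And>z y \<xi>. \<lbrakk>z \<in> Rn d; y \<in> Rn e; \<xi> \<in> \<Xi>\<rbrakk> \<Longrightarrow> 0 \<le> f z y \<xi>"
    and f_lsc: "lsc_on (Rn d \<times> Rn e \<times> \<Xi>) (\<lambda>(z, y, \<xi>). f z y \<xi>)"
    and f_convex: "\<And>\<xi>. \<xi> \<in> \<Xi> \<Longrightarrow> ereal_convex_on (Rn d \<times> Rn e) (\<lambda>(z, y). f z y \<xi>)"
    and Q_nonneg: "\<And>y. y \<in> Rn e \<Longrightarrow> 0 \<le> Q y"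
    and Q_lsc: "lsc_on (Rn e) Q"
    and Q_convex: "ereal_convex_on (Rn e) Q"
begin

text \<open>
  The stage value with the Lagrangian term replaced by the exact penalty that it represents.
\<close>

definition inf_conv :: "vec \<Rightarrow> vec \<Rightarrow> ereal" where
  "inf_conv x \<xi> = (INF (y, z)\<in>X \<times> Rn d. f z y \<xi> + Q y + ereal (M * N (x - z)))"

lemma summand_nonneg:
  assumes "x \<in> Rn d" "\<xi> \<in> \<Xi>" "y \<in> X" "z \<in> Rn d"
  shows "0 \<le> f z y \<xi> + Q y" "0 \<le> ereal (M * N (x - z))"
  using assms f_nonneg[of z y \<xi>] Q_nonneg[of y] X(1) M is_norm_nonneg[OF N, of "x - z"]
  by (auto simp: Rn_diff)

lemma inf_conv_nonneg: "x \<in> Rn d \<Longrightarrow> \<xi> \<in> \<Xi> \<Longrightarrow> 0 \<le> inf_conv x \<xi>"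
  unfolding inf_conv_def using summand_nonneg by (intro INF_greatest) (auto intro: add_nonneg_nonneg)

lemma inf_conv_Lipschitz:
  assumes "x \<in> Rn d" "x' \<in> Rn d" "\<xi> \<in> \<Xi>"
  shows "inf_conv x \<xi> \<le> inf_conv x' \<xi> + ereal (M * N (x - x'))"
  unfolding inf_conv_def INF_add_real[symmetric]
proof (rule INF_mono)
  fix w assume "w \<in> X \<times> Rn d"
  then obtain y z where w: "w = (y, z)" "y \<in> X" "z \<in> Rn d" by auto
  have "M * N (x - z) \<le> M * (N (x - x') + N (x' - z))"
    using w assms M by (intro mult_left_mono is_norm_triangle_diff[OF N]) auto
  then have "f z y \<xi> + Q y + ereal (M * N (x - z))
      \<le> f z y \<xi> + Q y + ereal (M * N (x' - z)) + ereal (M * N (x - x'))"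
    by (intro add_real_mono_split) (simp add: distrib_left)
  then show "\<exists>w'\<in>X \<times> Rn d. (case w' of (y, z) \<Rightarrow> f z y \<xi> + Q y + ereal (M * N (x - z)))
      \<le> (case w of (y, z) \<Rightarrow> f z y \<xi> + Q y + ereal (M * N (x' - z))) + ereal (M * N (x - x'))"
    using w by (intro bexI[of _ w]) auto
qed

text \<open>
  The penalized cost is jointly convex in \<open>x\<close>, \<open>y\<close> and \<open>z\<close>, and partial minimization preserves this.
\<close>

lemma inf_conv_convex:
  assumes \<xi>: "\<xi> \<in> \<Xi>"
  shows "ereal_convex_on (Rn d) (\<lambda>x. inf_conv x \<xi>)"
  unfolding inf_conv_def
proof (rule ereal_convex_on_INF)
  let ?D = "Rn d \<times> X \<times> Rn d"
  have D: "convex ?D" by (intro convex_Times convex_Rn X(3))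
  have "ereal_convex_on ?D (\<lambda>p. case (\<lambda>(x, y, z). (z, y)) p of (z, y) \<Rightarrow> f z y \<xi>)"
    using X(1) by (intro ereal_convex_on_compose[OF D f_convex[OF \<xi>]]) auto
  moreover have "ereal_convex_on ?D (\<lambda>p. Q ((\<lambda>(x, y, z). y) p))"
    using X(1) by (intro ereal_convex_on_compose[OF D Q_convex]) auto
  moreover have "ereal_convex_on ?D (\<lambda>p. ereal (M * N ((\<lambda>(x, y, z). x - z) p)))"
    using M by (intro ereal_convex_on_compose[OF D ereal_convex_on_real[OF convex_on_is_norm[OF N]]])
      (auto simp: algebra_simps Rn_diff)
  ultimately have "ereal_convex_on ?D (\<lambda>p. (case (\<lambda>(x, y, z). (z, y)) p of (z, y) \<Rightarrow> f z y \<xi>)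
      + Q ((\<lambda>(x, y, z). y) p) + ereal (M * N ((\<lambda>(x, y, z). x - z) p)))"
    using \<xi> X(1) f_nonneg Q_nonneg summand_nonneg
    by (intro ereal_convex_on_add D) (auto intro!: add_nonneg_nonneg)
  then show "ereal_convex_on ?D (\<lambda>(x, w). case w of (y, z) \<Rightarrow> f z y \<xi> + Q y + ereal (M * N (x - z)))"
    by (simp add: case_prod_unfold)
qed (auto intro!: convex_Rn convex_Times X)

lemma inf_conv_lipschitz_convex:
  "\<xi> \<in> \<Xi> \<Longrightarrow> lipschitz_convex d N M (\<lambda>x. inf_conv x \<xi>)"
  by (simp add: lipschitz_convex_def inf_conv_nonneg inf_conv_convex inf_conv_Lipschitz)

text \<open>
  Minimax: the subgradient of the infimal convolution at \<open>x\<close> is an optimal multiplier.  Conversely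
  every admissible multiplier is bounded by the penalty \<open>M * N (x - z)\<close>.
\<close>

lemma SUP_dual_eq_inf_conv:
  assumes x: "x \<in> Rn d" and \<xi>: "\<xi> \<in> \<Xi>"
  shows "(SUP l\<in>{l \<in> Rn d. dual_norm d N l \<le> M}.
            INF (y, z)\<in>X \<times> Rn d. f z y \<xi> + Q y + ereal (dot d l (x - z))) = inf_conv x \<xi>"
    (is "?L = _")
proof (rule antisym)
  show "?L \<le> inf_conv x \<xi>"
    unfolding inf_conv_def
  proof (intro SUP_least INF_mono)
    fix l w assume l: "l \<in> {l \<in> Rn d. dual_norm d N l \<le> M}" and "w \<in> X \<times> Rn d"
    then obtain y z where w: "w = (y, z)" "y \<in> X" "z \<in> Rn d" by auto
    have "dot d l (x - z) \<le> M * N (x - z)"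
      using l w x by (intro dot_le_dual_norm[OF N]) (auto intro: Rn_diff)
    then have "f z y \<xi> + Q y + ereal (dot d l (x - z)) \<le> f z y \<xi> + Q y + ereal (M * N (x - z))"
      by (intro add_left_mono) simp
    then show "\<exists>w'\<in>X \<times> Rn d. (case w' of (y, z) \<Rightarrow> f z y \<xi> + Q y + ereal (dot d l (x - z)))
        \<le> (case w of (y, z) \<Rightarrow> f z y \<xi> + Q y + ereal (M * N (x - z)))"
      using w by (intro bexI[of _ w]) auto
  qed
  have "inf_conv x \<xi> \<le> (SUP l\<in>{l \<in> Rn d. dual_norm d N l \<le> M}.
      INF z\<in>Rn d. inf_conv z \<xi> + ereal (dot d l (x - z)))"
    using M by (intro lipschitz_convex_le_biconjugate[OF N _ inf_conv_lipschitz_convex[OF \<xi>] x]) auto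
  also have "\<dots> \<le> ?L"
  proof (intro SUP_mono bexI INF_greatest)
    fix l w assume "w \<in> X \<times> Rn d"
    then obtain y z where w: "w = (y, z)" "y \<in> X" "z \<in> Rn d" by auto
    have "inf_conv z \<xi> \<le> f z y \<xi> + Q y"
      unfolding inf_conv_def using w by (intro INF_lower2[of w]) (auto simp: is_norm_zero[OF N])
    then have "inf_conv z \<xi> + ereal (dot d l (x - z)) \<le> f z y \<xi> + Q y + ereal (dot d l (x - z))"
      by (rule add_right_mono)
    then show "(INF z\<in>Rn d. inf_conv z \<xi> + ereal (dot d l (x - z)))
        \<le> (case w of (y, z) \<Rightarrow> f z y \<xi> + Q y + ereal (dot d l (x - z)))"
      using w by (auto intro: INF_lower2)
  qed
  finally show "inf_conv x \<xi> \<le> ?L" .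
qed

text \<open>Since the cost is nonnegative, the penalty confines \<open>z\<close> to a compact ball around \<open>x\<close>.\<close>

lemma inf_conv_lsc_uncert:
  assumes x: "x \<in> Rn d"
  shows "lsc_on \<Xi> (inf_conv x)"
  unfolding inf_conv_def
proof (rule lsc_on_INF_coercive)
  let ?D = "\<Xi> \<times> X \<times> Rn d"
  have "lsc_on ?D (\<lambda>p. case (\<lambda>(\<xi>, y, z). (z, y, \<xi>)) p of (z, y, \<xi>) \<Rightarrow> f z y \<xi>)"
    using X(1) by (intro lsc_on_compose[OF f_lsc])
      (auto simp: case_prod_unfold intro!: continuous_intros)
  moreover have "lsc_on ?D (\<lambda>p. Q (fst (snd p)))"
    using X(1) by (intro lsc_on_compose[OF Q_lsc]) (auto intro!: continuous_intros)
  moreover have "lsc_on ?D (\<lambda>p. ereal (M * N (x - snd (snd p))))"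
    using x by (intro lsc_on_continuous continuous_intros continuous_on_compose2[OF continuous_on_is_norm[OF N]])
      (auto intro: Rn_diff)
  ultimately have "lsc_on ?D (\<lambda>p. (case (\<lambda>(\<xi>, y, z). (z, y, \<xi>)) p of (z, y, \<xi>) \<Rightarrow> f z y \<xi>)
      + Q (fst (snd p)) + ereal (M * N (x - snd (snd p))))"
    using x X(1) f_nonneg Q_nonneg summand_nonneg
    by (intro lsc_on_add) (auto intro!: add_nonneg_nonneg)
  then show "lsc_on ?D (\<lambda>(\<xi>, w). case w of (y, z) \<Rightarrow> f z y \<xi> + Q y + ereal (M * N (x - z)))"
    by (simp add: case_prod_unfold)
next
  fix a :: real
  show "\<exists>K\<subseteq>X \<times> Rn d. compact K \<and> (\<forall>\<xi>\<in>\<Xi>. \<forall>w\<in>X \<times> Rn d.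
      (case w of (y, z) \<Rightarrow> f z y \<xi> + Q y + ereal (M * N (x - z))) < ereal a \<longrightarrow> w \<in> K)"
  proof (intro exI[of _ "X \<times> {z \<in> Rn d. N (z - x) \<le> a / M}"] conjI ballI impI)
    show "compact (X \<times> {z \<in> Rn d. N (z - x) \<le> a / M})"
      by (intro compact_Times X compact_is_norm_ball[OF N x])
    fix \<xi> w assume \<xi>: "\<xi> \<in> \<Xi>" and "w \<in> X \<times> Rn d"
      and le: "(case w of (y, z) \<Rightarrow> f z y \<xi> + Q y + ereal (M * N (x - z))) < ereal a"
    then obtain y z where w: "w = (y, z)" "y \<in> X" "z \<in> Rn d" by auto
    have "ereal (M * N (x - z)) \<le> f z y \<xi> + Q y + ereal (M * N (x - z))"
      using summand_nonneg(1)[OF x \<xi> w(2,3)] by (cases "f z y \<xi> + Q y") auto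
    also have "\<dots> < ereal a" using le w by simp
    finally have "N (z - x) \<le> a / M"
      using M is_norm_minus_commute[OF N x w(3)] by (simp add: field_simps)
    then show "w \<in> X \<times> {z \<in> Rn d. N (z - x) \<le> a / M}" using w by simp
  qed auto
qed

end

section \<open>Regularized cost-to-go functions\<close>

lemma valid_problem_conjuncts:
  assumes "valid_problem pb"
  shows "2 \<le> horizon pb"
    and "\<forall>t\<in>{0..horizon pb}. is_norm (sdim pb t) (snorm pb t)"
    and "init_state pb \<in> Rn (sdim pb 0)"
    and "uncert pb 1 = {init_uncert pb}"
    and "\<forall>t\<in>{1..horizon pb}.
        states pb t \<subseteq> Rn (sdim pb t) \<and> states pb t \<noteq> {} \<and>
        compact (states pb t) \<and> convex (states pb t)"
    and "\<forall>t\<in>{1..horizon pb}.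
        (\<forall>z\<in>Rn (sdim pb (t - 1)). \<forall>x\<in>Rn (sdim pb t). \<forall>\<xi>\<in>uncert pb t. 0 \<le> cost pb t z x \<xi>) \<and>
        lsc_on (Rn (sdim pb (t - 1)) \<times> Rn (sdim pb t) \<times> uncert pb t)
          (\<lambda>(z, x, \<xi>). cost pb t z x \<xi>) \<and>
        (\<forall>\<xi>\<in>uncert pb t.
           ereal_convex_on (Rn (sdim pb (t - 1)) \<times> Rn (sdim pb t)) (\<lambda>(z, x). cost pb t z x \<xi>))"
    and "\<forall>t\<in>{2..horizon pb}.
        ambiguity pb t \<noteq> {} \<and>
        (\<forall>p\<in>ambiguity pb t. prob_space p \<and> sets p = sets (restrict_space borel (uncert pb t)))"
    and "\<exists>x\<in>states pb 1. cost pb 1 (init_state pb) x (init_uncert pb) < \<infinity>"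
    and "\<forall>t\<in>{2..horizon pb}. 0 < reg pb t"
  by (insert assms, unfold valid_problem_def, (elim conjE, assumption)+)

lemma valid_problemD:
  assumes "valid_problem pb"
  shows "2 \<le> horizon pb"
    and "t \<le> horizon pb \<Longrightarrow> is_norm (sdim pb t) (snorm pb t)"
    and "1 \<le> t \<Longrightarrow> t \<le> horizon pb \<Longrightarrow> states pb t \<subseteq> Rn (sdim pb t)"
    and "1 \<le> t \<Longrightarrow> t < horizon pb \<Longrightarrow> 0 < reg pb (Suc t)"
  using valid_problem_conjuncts(1,2,5,9)[OF assms] by simp_all

text \<open>
  Backward induction over the stages.  At the horizon the cost-to-go function is constant, which is the
  case of Lipschitz constant \<open>0\<close>.
\<close>

lemma reg_ctg_lipschitz_convex_aux:
  assumes pb: "valid_problem pb" and "1 \<le> t" "t \<le> horizon pb"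
  shows "lipschitz_convex (sdim pb t) (snorm pb t) (if t < horizon pb then reg pb (Suc t) else 0)
           (reg_ctg pb t)"
  using assms(3,2)
proof (induction rule: inc_induct)
  case base
  have "reg_ctg pb (horizon pb) = (\<lambda>x. 0)" by (simp add: reg_ctg.simps)
  moreover have "ereal_convex_on (Rn d) (\<lambda>x. ereal 0)" for d
    by (intro ereal_convex_on_real) (simp add: convex_on_def convex_Rn)
  ultimately show ?case by (auto simp: lipschitz_convex_def zero_ereal_def)
next
  case (step t)
  let ?s = "Suc t" and ?d = "sdim pb t" and ?e = "sdim pb (Suc t)"
  define Q where "Q = reg_ctg pb ?s"
  define L where "L = (if ?s < horizon pb then reg pb (Suc ?s) else 0)"
  have range: "t \<in> {0..horizon pb}" "?s \<in> {0..horizon pb}" "?s \<in> {1..horizon pb}" "?s \<in> {2..horizon pb}"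
    using step by auto
  have N: "is_norm ?d (snorm pb t)" and N': "is_norm ?e (snorm pb ?s)"
    using bspec[OF valid_problem_conjuncts(2)[OF pb]] range(1,2) by blast+
  have X: "states pb ?s \<subseteq> Rn ?e" "compact (states pb ?s)" "convex (states pb ?s)"
    using bspec[OF valid_problem_conjuncts(5)[OF pb] range(3)] by simp_all
  note f = bspec[OF valid_problem_conjuncts(6)[OF pb] range(3), unfolded diff_Suc_1]
  note amb = bspec[OF valid_problem_conjuncts(7)[OF pb] range(4)]
  have M: "0 < reg pb ?s"
    by (rule bspec[OF valid_problem_conjuncts(9)[OF pb] range(4)])
  have "0 \<le> L"
  proof -
    have "0 < reg pb (Suc ?s)" if "?s < horizon pb"
      using that bspec[OF valid_problem_conjuncts(9)[OF pb], of "Suc ?s"] by simp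
    then show ?thesis by (auto simp: L_def less_imp_le)
  qed
  moreover have Q: "lipschitz_convex ?e (snorm pb ?s) L Q"
    using step.IH by (simp add: Q_def L_def)
  ultimately have Q_lsc: "lsc_on (Rn ?e) Q"
    using lipschitz_convex_lsc[OF N'] by blast
  interpret stage_data ?d ?e "snorm pb t" "reg pb ?s" "states pb ?s" "uncert pb ?s" "cost pb ?s" Q
    by unfold_locales (use N M X f Q_lsc lipschitz_convexD(1,2)[OF Q] in \<open>simp_all\<close>)
  have sv: "stage_value pb ?s Q x \<xi> = inf_conv x \<xi>" if "x \<in> Rn ?d" "\<xi> \<in> uncert pb ?s" for x \<xi>
    using SUP_dual_eq_inf_conv[OF that] by (simp add: stage_value_def)
  define J where "J p x = enn2ereal (\<integral>\<^sup>+ \<xi>. e2ennreal (stage_value pb ?s Q x \<xi>) \<partial>p)" for p x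
  have "lipschitz_convex ?d (snorm pb t) (reg pb ?s) (J p)" if p: "p \<in> ambiguity pb ?s" for p
    unfolding J_def
  proof (rule lipschitz_convex_expectation)
    show "prob_space p" "sets p = sets (restrict_space borel (uncert pb ?s))" using amb p by blast+
    show "lipschitz_convex ?d (snorm pb t) (reg pb ?s) (\<lambda>x. stage_value pb ?s Q x \<xi>)"
      if \<xi>: "\<xi> \<in> uncert pb ?s" for \<xi>
      using inf_conv_lipschitz_convex[OF \<xi>] unfolding lipschitz_convex_def ereal_convex_on_def
      by (simp add: sv \<xi> cong: conj_cong)
    show "lsc_on (uncert pb ?s) (stage_value pb ?s Q x)" if x: "x \<in> Rn ?d" for x
      using inf_conv_lsc_uncert[OF x] unfolding lsc_on_def by (simp add: sv x cong: conj_cong)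
  qed (use N M in auto)
  then have "lipschitz_convex ?d (snorm pb t) (reg pb ?s) (\<lambda>x. SUP p\<in>ambiguity pb ?s. J p x)"
    by (rule lipschitz_convex_SUP[OF conjunct1[OF amb]])
  moreover have "reg_ctg pb t = (\<lambda>x. SUP p\<in>ambiguity pb ?s. J p x)"
    using step by (subst reg_ctg.simps) (simp add: J_def Q_def)
  ultimately show ?case using step by simp
qed

lemma reg_ctg_lipschitz_convex:
  assumes "valid_problem pb" "1 \<le> t" "t < horizon pb"
  shows "lipschitz_convex (sdim pb t) (snorm pb t) (reg pb (Suc t)) (reg_ctg pb t)"
  using reg_ctg_lipschitz_convex_aux[of pb t] assms by simp

lemma reg_ctg_nonneg:
  assumes "valid_problem pb" "1 \<le> t" "t \<le> horizon pb" "x \<in> Rn (sdim pb t)"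
  shows "0 \<le> reg_ctg pb t x"
  using lipschitz_convexD(1)[OF reg_ctg_lipschitz_convex_aux[OF assms(1-3)] assms(4)] .

section \<open>The convex hull of two over-approximations\<close>

lemma conv_min_le:
  assumes "x \<in> Rn d"
  shows "conv_min d h1 h2 x \<le> h1 x" "conv_min d h1 h2 x \<le> h2 x"
  unfolding conv_min_def using assms by (auto intro!: SUP_least INF_lower2[of x])

lemma conv_min_lsc: "lsc_on S (conv_min d h1 h2)"
proof -
  have "lsc_on S (\<lambda>x. SUP l\<in>Rn d. INF z\<in>Rn d. min (h1 z) (h2 z) + ereal (dot d l (x - z)))"
    using Rn_0 by (intro lsc_on_SUP lsc_on_INF_affine) blast
  then show ?thesis by (simp add: conv_min_def[abs_def])
qed

lemma conv_min_convex: "convex S \<Longrightarrow> ereal_convex_on S (conv_min d h1 h2)"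
proof -
  assume "convex S"
  then have "ereal_convex_on S (\<lambda>x. SUP l\<in>Rn d. INF z\<in>Rn d. min (h1 z) (h2 z) + ereal (dot d l (x - z)))"
    by (intro ereal_convex_on_SUP ereal_convex_on_INF_affine)
  then show ?thesis by (simp add: conv_min_def[abs_def])
qed

text \<open>
  The infimum in \<^const>\<open>conv_min\<close> ranges over all of \<open>Rn d\<close>, so \<open>Q\<close> must lie below both functions
  there, and not only on the state space.
\<close>

lemma le_conv_min:
  assumes N: "is_norm d N" and M: "0 \<le> M" and Q: "lipschitz_convex d N M Q" and x: "x \<in> Rn d"
    and le: "\<And>z. z \<in> Rn d \<Longrightarrow> Q z \<le> h1 z" "\<And>z. z \<in> Rn d \<Longrightarrow> Q z \<le> h2 z"
  shows "Q x \<le> conv_min d h1 h2 x"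
proof -
  have "Q x \<le> (SUP l\<in>{l \<in> Rn d. dual_norm d N l \<le> M}. INF z\<in>Rn d. Q z + ereal (dot d l (x - z)))"
    by (rule lipschitz_convex_le_biconjugate[OF N M Q x])
  also have "\<dots> \<le> conv_min d h1 h2 x"
    unfolding conv_min_def
  proof (rule SUP_subset_mono)
    fix l
    show "(INF z\<in>Rn d. Q z + ereal (dot d l (x - z)))
        \<le> (INF z\<in>Rn d. min (h1 z) (h2 z) + ereal (dot d l (x - z)))"
      by (rule INF_mono) (use le in \<open>auto intro!: bexI add_right_mono\<close>)
  qed auto
  finally show ?thesis .
qed

section \<open>Packing\<close>

text \<open>
  Lebesgue measure on \<open>d\<close>-tuples, with \<open>d\<close> a number rather than a type.
\<close>

definition coord_vol :: "nat \<Rightarrow> (nat \<Rightarrow> real) measure" where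
  "coord_vol d = PiM {..<d} (\<lambda>_. lborel)"

lemma space_coord_vol: "space (coord_vol d) = {..<d} \<rightarrow>\<^sub>E UNIV"
  by (simp add: coord_vol_def space_PiM)

lemma emeasure_lborel_homothety:
  fixes A :: "real set"
  assumes "A \<in> sets borel" "s \<noteq> 0"
  shows "emeasure lborel {y. a + s * y \<in> A} * ennreal \<bar>s\<bar> = emeasure lborel A"
proof -
  have "emeasure lborel A = emeasure (density (distr lborel borel (\<lambda>x. a + s * x)) (\<lambda>_. ennreal \<bar>s\<bar>)) A"
    using lborel_real_affine[OF assms(2), of a] by simp
  also have "\<dots> = ennreal \<bar>s\<bar> * emeasure lborel ((\<lambda>x. a + s * x) -` A)"
    using assms(1) by (subst emeasure_density_const) (auto simp: emeasure_distr)
  finally show ?thesis by (simp add: vimage_def mult.commute)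
qed

lemma measurable_homothety:
  "(\<lambda>f. \<lambda>i\<in>{..<d}. a i + s * f i) \<in> coord_vol d \<rightarrow>\<^sub>M coord_vol d"
  unfolding coord_vol_def
proof (rule measurable_restrict)
  fix i assume "i \<in> {..<d}"
  then have "(\<lambda>f. f i) \<in> PiM {..<d} (\<lambda>_. lborel) \<rightarrow>\<^sub>M (lborel :: real measure)"
    by (rule measurable_component_singleton)
  then have "(\<lambda>f. f i) \<in> borel_measurable (PiM {..<d} (\<lambda>_. lborel :: real measure))"
    by (simp only: measurable_lborel1)
  then have "(\<lambda>f. a i + s * f i) \<in> borel_measurable (PiM {..<d} (\<lambda>_. lborel))"
    by (intro borel_measurable_add borel_measurable_times borel_measurable_const)
  then show "(\<lambda>f. a i + s * f i) \<in> PiM {..<d} (\<lambda>_. lborel) \<rightarrow>\<^sub>M lborel"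
    by (simp only: measurable_lborel1)
qed

text \<open>
  Product measures are determined by their values on boxes, where the coordinates separate.
\<close>

lemma coord_vol_homothety:
  assumes "0 < s"
  shows "coord_vol d = scale_measure (ennreal (s ^ d))
           (distr (coord_vol d) (coord_vol d) (\<lambda>f. \<lambda>i\<in>{..<d}. a i + s * f i))"
proof -
  interpret product_sigma_finite "\<lambda>_::nat. lborel :: real measure" by standard
  let ?g = "\<lambda>f. \<lambda>i\<in>{..<d}. a i + s * f i"
  have meas: "?g \<in> coord_vol d \<rightarrow>\<^sub>M coord_vol d"
    by (rule measurable_homothety)
  have "scale_measure (ennreal (s ^ d)) (distr (coord_vol d) (coord_vol d) ?g) = PiM {..<d} (\<lambda>_. lborel)"
  proof (rule PiM_eqI)
    fix A :: "nat \<Rightarrow> real set" assume A: "\<And>i. i \<in> {..<d} \<Longrightarrow> A i \<in> sets lborel"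
    have box: "Pi\<^sub>E {..<d} A \<in> sets (coord_vol d)"
      unfolding coord_vol_def using A by (intro sets_PiM_I_finite) auto
    have pre: "?g -` Pi\<^sub>E {..<d} A \<inter> space (coord_vol d) = (\<Pi>\<^sub>E i\<in>{..<d}. {y. a i + s * y \<in> A i})"
    proof (intro set_eqI)
      fix f
      have "f \<in> ?g -` Pi\<^sub>E {..<d} A \<inter> space (coord_vol d) \<longleftrightarrow>
          (\<forall>i\<in>{..<d}. a i + s * f i \<in> A i) \<and> f \<in> extensional {..<d}"
        by (simp add: space_coord_vol PiE_iff)
      also have "\<dots> \<longleftrightarrow> f \<in> (\<Pi>\<^sub>E i\<in>{..<d}. {y. a i + s * y \<in> A i})"
        by (simp add: PiE_iff)
      finally show "f \<in> ?g -` Pi\<^sub>E {..<d} A \<inter> space (coord_vol d) \<longleftrightarrow>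
          f \<in> (\<Pi>\<^sub>E i\<in>{..<d}. {y. a i + s * y \<in> A i})" .
    qed
    have pre_meas: "{y. a i + s * y \<in> A i} \<in> sets lborel" if "i < d" for i
    proof -
      have "(\<lambda>y. a i + s * y) -` A i \<inter> space borel \<in> sets borel"
        using A[of i] that by (intro measurable_sets[of _ borel borel]) auto
      then show ?thesis by (simp add: vimage_def)
    qed
    have "emeasure (scale_measure (ennreal (s ^ d)) (distr (coord_vol d) (coord_vol d) ?g)) (Pi\<^sub>E {..<d} A)
        = ennreal (s ^ d) * emeasure (coord_vol d) (\<Pi>\<^sub>E i\<in>{..<d}. {y. a i + s * y \<in> A i})"
      using box meas pre by (simp add: emeasure_distr)
    also have "\<dots> = ennreal (s ^ d) * (\<Prod>i<d. emeasure lborel {y. a i + s * y \<in> A i})"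
      unfolding coord_vol_def using pre_meas by (subst emeasure_PiM) auto
    also have "\<dots> = (\<Prod>i<d. emeasure lborel {y. a i + s * y \<in> A i} * ennreal \<bar>s\<bar>)"
      using assms by (simp add: prod.distrib ennreal_power mult.commute)
    also have "\<dots> = (\<Prod>i<d. emeasure lborel (A i))"
      using A assms by (intro prod.cong refl emeasure_lborel_homothety) auto
    finally show "emeasure (scale_measure (ennreal (s ^ d)) (distr (coord_vol d) (coord_vol d) ?g)) (Pi\<^sub>E {..<d} A)
        = (\<Prod>i\<in>{..<d}. emeasure lborel (A i))" .
  qed (auto simp: coord_vol_def)
  then show ?thesis by (simp add: coord_vol_def)
qed

definition norm_ball :: "nat \<Rightarrow> (vec \<Rightarrow> real) \<Rightarrow> vec \<Rightarrow> real \<Rightarrow> (nat \<Rightarrow> real) set" where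
  "norm_ball d N c r = {f \<in> space (coord_vol d). N (vec_of d f - c) < r}"

context
  fixes d N
  assumes N: "is_norm d N"
begin

text \<open>
  The norm is continuous on the space of all sequences, where the Borel sets are the measurable sets of
  the product; this transfers to tuples by padding with zeros.
\<close>

lemma norm_ball_measurable:
  assumes c: "c \<in> Rn d"
  shows "norm_ball d N c r \<in> sets (coord_vol d)"
proof -
  have "continuous_on UNIV (\<lambda>f. N (vec_of d f - c))"
    using c by (intro continuous_on_compose2[OF continuous_on_is_norm[OF N]] continuous_intros continuous_on_vec_of)
      (auto intro: Rn_diff)
  then have "(\<lambda>f. N (vec_of d f - c)) \<in> borel_measurable (PiM UNIV (\<lambda>_::nat. borel))"
    by (simp add: borel_measurable_continuous_onI measurable_cong_sets[OF sets_PiM_equal_borel refl])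
  moreover have "(\<lambda>f i. if i \<in> {..<d} then f i else 0) \<in> coord_vol d \<rightarrow>\<^sub>M PiM UNIV (\<lambda>_::nat. borel)"
    unfolding coord_vol_def
  proof (rule measurable_PiM_single')
    fix i :: nat
    show "(\<lambda>f. if i \<in> {..<d} then f i else 0) \<in> borel_measurable (PiM {..<d} (\<lambda>_. lborel))"
      by (cases "i < d") (auto intro: measurable_component_singleton)
  qed auto
  ultimately have "(\<lambda>f. N (vec_of d (\<lambda>i. if i \<in> {..<d} then f i else 0) - c)) \<in> borel_measurable (coord_vol d)"
    by (rule measurable_compose_rev)
  moreover have "vec_of d (\<lambda>i. if i \<in> {..<d} then f i else 0) = vec_of d f" for f
    by (intro poly_mapping_eqI) simp
  ultimately show ?thesis
    unfolding norm_ball_def by simp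
qed

lemma emeasure_norm_ball:
  assumes c: "c \<in> Rn d" and r: "0 < r"
  shows "emeasure (coord_vol d) (norm_ball d N c r)
       = ennreal (r ^ d) * emeasure (coord_vol d) (norm_ball d N 0 1)"
proof -
  let ?g = "\<lambda>f. \<lambda>i\<in>{..<d}. Poly_Mapping.lookup c i + r * f i"
  have meas: "?g \<in> coord_vol d \<rightarrow>\<^sub>M coord_vol d"
    by (rule measurable_homothety)
  have "vec_of d (?g f) - c = r *\<^sub>R vec_of d f" for f
    using c by (intro poly_mapping_eqI) (auto simp: lookup_minus Rn_def)
  then have "N (vec_of d (?g f) - c) = r * N (vec_of d f)" for f
    using r by (simp add: is_norm_scaleR[OF N])
  then have "?g -` norm_ball d N c r \<inter> space (coord_vol d) = norm_ball d N 0 1"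
    using r by (auto simp: norm_ball_def space_coord_vol)
  then show ?thesis
    using meas norm_ball_measurable[OF c]
    by (subst coord_vol_homothety[OF r, of d "Poly_Mapping.lookup c"]) (simp add: emeasure_distr)
qed

lemma emeasure_box:
  "emeasure (coord_vol d) ({..<d} \<rightarrow>\<^sub>E {- b<..<b}) = ennreal ((2 * b) ^ d)" if "0 \<le> b"
proof -
  interpret product_sigma_finite "\<lambda>_::nat. lborel :: real measure" by standard
  show ?thesis
    unfolding coord_vol_def using that by (subst emeasure_PiM) (auto simp: ennreal_power)
qed

text \<open>The unit ball contains a box and is contained in another one.\<close>

lemma emeasure_unit_norm_ball:
  "emeasure (coord_vol d) (norm_ball d N 0 1) \<noteq> 0"
  "emeasure (coord_vol d) (norm_ball d N 0 1) \<noteq> \<infinity>"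
proof -
  obtain C where C: "0 \<le> C" "\<And>x. x \<in> Rn d \<Longrightarrow> N x \<le> C * norm x"
    using is_norm_le_norm[OF N] by blast
  \<comment> \<open>The ambient norm is at most \<open>d * b\<close> on the box, so \<open>N\<close> is at most \<open>C * d * b < 1\<close> there.\<close>
  define b where "b = 1 / (1 + C * real d)"
  have b: "0 < b" "C * (real d * b) < 1"
    using C(1) by (auto simp: b_def field_simps add_pos_nonneg)
  have "({..<d} \<rightarrow>\<^sub>E {- b<..<b}) \<subseteq> norm_ball d N 0 1"
  proof
    fix f assume f: "f \<in> {..<d} \<rightarrow>\<^sub>E {- b<..<b}"
    have "norm (vec_of d f) = (\<Sum>i<d. \<bar>f i\<bar>)" by (simp add: norm_Rn[OF vec_of_in_Rn])
    also have "\<dots> \<le> (\<Sum>i<d. b)"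
      using f by (intro sum_mono) (auto simp: PiE_iff abs_le_iff less_imp_le minus_le_iff)
    finally have "C * norm (vec_of d f) \<le> C * (real d * b)" using C(1) by (simp add: mult_left_mono)
    then have "N (vec_of d f) < 1" using C(2)[of "vec_of d f"] b by simp
    then show "f \<in> norm_ball d N 0 1" using f by (auto simp: norm_ball_def space_coord_vol)
  qed
  then have "ennreal ((2 * b) ^ d) \<le> emeasure (coord_vol d) (norm_ball d N 0 1)"
    using emeasure_mono[OF _ norm_ball_measurable[of 0 1], of "{..<d} \<rightarrow>\<^sub>E {- b<..<b}"] b
    by (simp add: emeasure_box)
  moreover have "0 < ennreal ((2 * b) ^ d)" using b by simp
  ultimately show "emeasure (coord_vol d) (norm_ball d N 0 1) \<noteq> 0"
    by (metis less_le_trans less_irrefl)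
next
  obtain C where C: "0 < C" "\<And>x. x \<in> Rn d \<Longrightarrow> norm x \<le> C * N x"
    using norm_le_is_norm[OF N] by blast
  have "norm_ball d N 0 1 \<subseteq> {..<d} \<rightarrow>\<^sub>E {- C<..<C}"
  proof
    fix f assume f: "f \<in> norm_ball d N 0 1"
    have "\<bar>f i\<bar> < C" if "i < d" for i
    proof -
      have "\<bar>f i\<bar> \<le> norm (vec_of d f)" using abs_lookup_le_norm[of "vec_of d f" i] that by simp
      also have "\<dots> \<le> C * N (vec_of d f)" by (rule C) simp
      also have "\<dots> < C * 1" using f C(1) unfolding norm_ball_def by (intro mult_strict_left_mono) auto
      finally show ?thesis by simp
    qed
    then show "f \<in> {..<d} \<rightarrow>\<^sub>E {- C<..<C}"
      using f by (auto simp: norm_ball_def space_coord_vol PiE_iff abs_less_iff minus_less_iff)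
  qed
  moreover have "({..<d} \<rightarrow>\<^sub>E {- C<..<C}) \<in> sets (coord_vol d)"
    unfolding coord_vol_def by (intro sets_PiM_I_finite) auto
  ultimately have "emeasure (coord_vol d) (norm_ball d N 0 1)
      \<le> emeasure (coord_vol d) ({..<d} \<rightarrow>\<^sub>E {- C<..<C})"
    by (rule emeasure_mono)
  also have "\<dots> = ennreal ((2 * C) ^ d)" using C(1) by (intro emeasure_box) auto
  finally have "emeasure (coord_vol d) (norm_ball d N 0 1) \<le> ennreal ((2 * C) ^ d)" .
  then show "emeasure (coord_vol d) (norm_ball d N 0 1) \<noteq> \<infinity>" by (auto simp: top_unique)
qed

text \<open>
  The balls of radius \<open>r / 2\<close> around \<open>r\<close>-separated points are disjoint, and if the points lie in a ball
  of diameter \<open>D\<close> these balls lie in the concentric ball of radius \<open>D / 2 + r / 2\<close>.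
\<close>

lemma card_separated_le:
  assumes fin: "finite P" and c: "c \<in> Rn d" and r: "0 < r" and D: "0 \<le> D"
    and P: "\<And>x. x \<in> P \<Longrightarrow> x \<in> Rn d \<and> N (x - c) \<le> D / 2"
    and sep: "\<And>x y. x \<in> P \<Longrightarrow> y \<in> P \<Longrightarrow> x \<noteq> y \<Longrightarrow> r \<le> N (x - y)"
  shows "real (card P) \<le> (1 + D / r) ^ d"
proof -
  let ?V = "coord_vol d"
  define U where "U = emeasure ?V (norm_ball d N 0 1)"
  define R where "R = D / 2 + r / 2"
  have U: "U \<noteq> 0" "U \<noteq> \<infinity>" using emeasure_unit_norm_ball by (auto simp: U_def)
  have R: "0 < R" using r D by (simp add: R_def)
  have disj: "disjoint_family_on (\<lambda>x. norm_ball d N x (r / 2)) P"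
    unfolding disjoint_family_on_def
  proof (intro ballI impI)
    fix x y assume xy: "x \<in> P" "y \<in> P" "x \<noteq> y"
    have "False" if f: "f \<in> norm_ball d N x (r / 2)" "f \<in> norm_ball d N y (r / 2)" for f
    proof -
      have "N (x - y) \<le> N (x - vec_of d f) + N (vec_of d f - y)"
        using P xy by (intro is_norm_triangle_diff[OF N]) auto
      also have "\<dots> < r"
        using f is_norm_minus_commute[OF N, of x "vec_of d f"] P[OF xy(1)] by (simp add: norm_ball_def)
      finally show False using sep[OF xy] by simp
    qed
    then show "norm_ball d N x (r / 2) \<inter> norm_ball d N y (r / 2) = {}" by blast
  qed
  have sub: "(\<Union>x\<in>P. norm_ball d N x (r / 2)) \<subseteq> norm_ball d N c R"
  proof
    fix f assume "f \<in> (\<Union>x\<in>P. norm_ball d N x (r / 2))"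
    then obtain x where x: "x \<in> P" "f \<in> norm_ball d N x (r / 2)" by blast
    have "N (vec_of d f - c) \<le> N (vec_of d f - x) + N (x - c)"
      using P[OF x(1)] c by (intro is_norm_triangle_diff[OF N]) auto
    then have "N (vec_of d f - c) < R" using x P[OF x(1)] by (simp add: norm_ball_def R_def)
    then show "f \<in> norm_ball d N c R" using x by (simp add: norm_ball_def)
  qed
  have "ennreal (real (card P) * (r / 2) ^ d) * U = (\<Sum>x\<in>P. ennreal ((r / 2) ^ d) * U)"
    using r by (simp add: ennreal_mult ennreal_of_nat_eq_real_of_nat mult.assoc)
  also have "\<dots> = (\<Sum>x\<in>P. emeasure ?V (norm_ball d N x (r / 2)))"
    unfolding U_def using P r by (intro sum.cong refl emeasure_norm_ball[symmetric]) auto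
  also have "\<dots> = emeasure ?V (\<Union>x\<in>P. norm_ball d N x (r / 2))"
    using P by (intro sum_emeasure disj fin) (auto intro: norm_ball_measurable)
  also have "\<dots> \<le> emeasure ?V (norm_ball d N c R)"
    by (intro emeasure_mono sub norm_ball_measurable c)
  also have "\<dots> = ennreal (R ^ d) * U"
    unfolding U_def by (rule emeasure_norm_ball[OF c R])
  finally have "ennreal (real (card P) * (r / 2) ^ d) \<le> ennreal (R ^ d)"
    using U ennreal_mult_le_mult_iff[of U] by (simp add: mult.commute[of _ U])
  then have "real (card P) * (r / 2) ^ d \<le> R ^ d"
    using R by simp
  then have "real (card P) \<le> R ^ d / (r / 2) ^ d"
    using r by (simp add: pos_le_divide_eq)
  also have "\<dots> = (R / (r / 2)) ^ d" by (simp add: power_divide)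
  also have "R / (r / 2) = 1 + D / r" using r by (simp add: R_def field_simps)
  finally show ?thesis .
qed

end

section \<open>The algorithm\<close>

text \<open>
  Stronger than \<^const>\<open>approx_pair\<close>: the over-approximation dominates on the whole space, because the
  convex hull in its update mixes values from the whole space (\<open>le_conv_min\<close>).
\<close>

definition sound_approx :: "problem \<Rightarrow> nat \<Rightarrow> (vec \<Rightarrow> ereal) \<Rightarrow> (vec \<Rightarrow> ereal) \<Rightarrow> bool" where
  "sound_approx pb t low up \<longleftrightarrow>
     lsc_on (Rn (sdim pb t)) low \<and> ereal_convex_on (Rn (sdim pb t)) low \<and>
     lsc_on (Rn (sdim pb t)) up \<and> ereal_convex_on (Rn (sdim pb t)) up \<and>
     (\<forall>x\<in>Rn (sdim pb t). \<bar>low x\<bar> \<noteq> \<infinity> \<and> reg_ctg pb t x \<le> up x) \<and>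
     (\<forall>x\<in>states pb t. low x \<le> reg_ctg pb t x)"

lemma sound_approx_imp_approx_pair:
  assumes "valid_problem pb" "1 \<le> t" "t \<le> horizon pb" "sound_approx pb t low up"
  shows "approx_pair pb t low up"
proof -
  have "up x \<noteq> - \<infinity>" if "x \<in> Rn (sdim pb t)" for x
  proof -
    have "0 \<le> up x"
      using reg_ctg_nonneg[OF assms(1-3) that] assms(4) that
      unfolding sound_approx_def by (meson order_trans)
    then show ?thesis by auto
  qed
  then show ?thesis
    using assms(4) valid_problemD(3)[OF assms(1-3)]
    unfolding approx_pair_def sound_approx_def by (simp add: subset_iff)
qed

text \<open>
  The over-approximation after a backward move, with \<open>xp\<close> the state and \<open>v\<close> the value of the cut.
\<close>

definition over_cut :: "problem \<Rightarrow> nat \<Rightarrow> vec \<Rightarrow> ereal \<Rightarrow> (vec \<Rightarrow> ereal) \<Rightarrow> vec \<Rightarrow> ereal" where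
  "over_cut pb t xp v up =
     conv_min (sdim pb t) up (\<lambda>z. v + ereal (reg pb (Suc t) * snorm pb t (z - xp)))"

lemma sound_approx_update:
  assumes pb: "valid_problem pb" and t: "1 \<le> t" "t < horizon pb"
    and sound: "sound_approx pb t low up" and xp: "xp \<in> Rn (sdim pb t)"
    and V: "affine_fun (sdim pb t) V" "\<And>z. z \<in> states pb t \<Longrightarrow> ereal (V z) \<le> reg_ctg pb t z"
    and v: "reg_ctg pb t xp \<le> v"
  shows "sound_approx pb t (\<lambda>z. max (low z) (ereal (V z))) (over_cut pb t xp v up)"
proof -
  let ?d = "sdim pb t"
  have t': "t \<le> horizon pb" using t by simp
  note N = valid_problemD(2)[OF pb t']
  note ctg = reg_ctg_lipschitz_convex[OF pb t]
  from V(1) obtain a b where ab: "\<And>x. x \<in> Rn ?d \<Longrightarrow> V x = dot ?d a x + b"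
    by (auto simp: affine_fun_def)
  have "continuous_on (Rn ?d) V"
    using ab by (subst continuous_on_cong[OF refl ab]) (auto intro!: continuous_intros continuous_on_dot)
  then have V_lsc: "lsc_on (Rn ?d) (\<lambda>z. ereal (V z))" by (rule lsc_on_continuous)
  have "convex_on (Rn ?d) V"
  proof (rule convex_onI)
    fix s x y assume xy: "x \<in> Rn ?d" "y \<in> Rn ?d"
    then have "V ((1 - s) *\<^sub>R x + s *\<^sub>R y) = dot ?d a ((1 - s) *\<^sub>R x + s *\<^sub>R y) + b"
      by (intro ab Rn_add Rn_scaleR)
    also have "\<dots> = (1 - s) * V x + s * V y"
      unfolding dot_add dot_scaleR using xy by (simp add: ab algebra_simps)
    finally show "V ((1 - s) *\<^sub>R x + s *\<^sub>R y) \<le> (1 - s) * V x + s * V y" by simp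
  qed (rule convex_Rn)
  then have V_conv: "ereal_convex_on (Rn ?d) (\<lambda>z. ereal (V z))" by (rule ereal_convex_on_real)
  have "reg_ctg pb t x \<le> over_cut pb t xp v up x" if x: "x \<in> Rn ?d" for x
    unfolding over_cut_def
  proof (rule le_conv_min[OF N _ ctg x])
    fix z assume z: "z \<in> Rn ?d"
    show "reg_ctg pb t z \<le> up z" using sound z by (simp add: sound_approx_def)
    have "reg_ctg pb t z \<le> reg_ctg pb t xp + ereal (reg pb (Suc t) * snorm pb t (z - xp))"
      by (rule lipschitz_convexD(3)[OF ctg z xp])
    also have "\<dots> \<le> v + ereal (reg pb (Suc t) * snorm pb t (z - xp))"
      using v by (rule add_right_mono)
    finally show "reg_ctg pb t z \<le> v + ereal (reg pb (Suc t) * snorm pb t (z - xp))" .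
  qed (use valid_problemD(4)[OF pb t] in simp)
  moreover have "\<bar>max (low x) (ereal (V x))\<bar> \<noteq> \<infinity>" if "x \<in> Rn ?d" for x
    using sound that by (auto simp: sound_approx_def max_def)
  ultimately show ?thesis
    using sound V_lsc V_conv V(2) unfolding sound_approx_def over_cut_def
    by (auto intro!: lsc_on_max ereal_convex_on_max conv_min_lsc conv_min_convex convex_Rn)
qed

text \<open>
  The trace that a cut at \<open>p\<close> leaves for the rest of the run: the gap is at most \<open>c\<close> at \<open>p\<close> and grows
  at most with twice the Lipschitz constant.
\<close>

definition gap_near :: "problem \<Rightarrow> nat \<Rightarrow> (vec \<Rightarrow> ereal) \<Rightarrow> (vec \<Rightarrow> ereal) \<Rightarrow> real \<Rightarrow> vec \<Rightarrow> bool" where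
  "gap_near pb t low up c p \<longleftrightarrow>
     (\<forall>z\<in>Rn (sdim pb t). up z \<le> low z + ereal (c + 2 * reg pb (Suc t) * snorm pb t (z - p)))"

lemma gap_near_mono:
  assumes "gap_near pb t low up c p"
    and "\<And>z. z \<in> Rn (sdim pb t) \<Longrightarrow> low z \<le> low' z" "\<And>z. z \<in> Rn (sdim pb t) \<Longrightarrow> up' z \<le> up z"
  shows "gap_near pb t low' up' c p"
  using assms unfolding gap_near_def by (meson add_right_mono order_trans)

text \<open>
  The new approximations are at least as good as the cut itself, whose upper and lower halves
  separate with slope \<open>reg pb (t + 1)\<close> each.
\<close>

lemma gap_near_update:
  assumes N: "is_norm (sdim pb t) (snorm pb t)" and xp: "xp \<in> Rn (sdim pb t)"
    and V: "lipschitz_fun (sdim pb t) (snorm pb t) (reg pb (Suc t)) V"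
    and v: "v - ereal (V xp) \<le> ereal c"
  shows "gap_near pb t (\<lambda>z. max (low z) (ereal (V z))) (over_cut pb t xp v up) c xp"
  unfolding gap_near_def
proof
  fix z assume z: "z \<in> Rn (sdim pb t)"
  let ?n = "reg pb (Suc t) * snorm pb t (z - xp)"
  have "over_cut pb t xp v up z \<le> v + ereal ?n"
    unfolding over_cut_def using z by (rule conv_min_le)
  also have "\<dots> \<le> ereal (V xp + c) + ereal ?n"
    using v by (cases v) (auto simp: algebra_simps)
  also have "\<dots> \<le> ereal (V z) + ereal (c + 2 * reg pb (Suc t) * snorm pb t (z - xp))"
    using V z xp unfolding lipschitz_fun_def by (force simp: abs_le_iff)
  also have "\<dots> \<le> max (low z) (ereal (V z)) + ereal (c + 2 * reg pb (Suc t) * snorm pb t (z - xp))"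
    by (intro add_right_mono) simp
  finally show "over_cut pb t xp v up z
      \<le> max (low z) (ereal (V z)) + ereal (c + 2 * reg pb (Suc t) * snorm pb t (z - xp))" .
qed

text \<open>
  The distance from \<open>p\<close> at which the bound of \<^const>\<open>gap_near\<close> with \<open>c = \<delta> (t + 1)\<close> rises to \<open>\<delta> t\<close>.
\<close>

definition separation :: "problem \<Rightarrow> (nat \<Rightarrow> real) \<Rightarrow> nat \<Rightarrow> real" where
  "separation pb \<delta> t = (\<delta> t - \<delta> (Suc t)) / (2 * reg pb (Suc t))"

text \<open>
  \<open>P t\<close> is the set of states at which the algorithm has moved forward from stage \<open>t\<close>.  A cut has been
  added at each of them, with one exception: while the current stage is beyond \<open>t\<close>, the cut at the
  current state of stage \<open>t\<close> is still pending.
\<close>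

definition nddp_inv ::
    "problem \<Rightarrow> (nat \<Rightarrow> real) \<Rightarrow> (nat \<Rightarrow> vec set) \<Rightarrow> nddp_state \<Rightarrow> bool" where
  "nddp_inv pb \<delta> P s \<longleftrightarrow>
     1 \<le> cur_stage s \<and> cur_stage s \<le> horizon pb \<and>
     (\<forall>t. 1 \<le> t \<and> t \<le> horizon pb \<longrightarrow> sound_approx pb t (under s t) (over s t)) \<and>
     under s (horizon pb) = (\<lambda>x. 0) \<and> over s (horizon pb) = (\<lambda>x. 0) \<and>
     (\<forall>t. 1 \<le> t \<and> t < horizon pb \<longrightarrow>
        finite (P t) \<and> P t \<subseteq> states pb t \<and>
        (\<forall>p\<in>P t. \<forall>q\<in>P t. p \<noteq> q \<longrightarrow> separation pb \<delta> t \<le> snorm pb t (p - q)) \<and>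
        (t < cur_stage s \<longrightarrow> cur_state s t \<in> P t) \<and>
        (\<forall>p\<in>P t. t < cur_stage s \<and> p = cur_state s t \<or>
           gap_near pb t (under s t) (over s t) (\<delta> (Suc t)) p))"

lemma nddp_invD:
  assumes "nddp_inv pb \<delta> P s" "1 \<le> t" "t < horizon pb"
  shows "finite (P t)" "P t \<subseteq> states pb t"
    "\<And>p q. p \<in> P t \<Longrightarrow> q \<in> P t \<Longrightarrow> p \<noteq> q \<Longrightarrow> separation pb \<delta> t \<le> snorm pb t (p - q)"
    "t < cur_stage s \<Longrightarrow> cur_state s t \<in> P t"
    "\<And>p. p \<in> P t \<Longrightarrow> t < cur_stage s \<and> p = cur_state s t \<or>
       gap_near pb t (under s t) (over s t) (\<delta> (Suc t)) p"
  using assms unfolding nddp_inv_def by simp_all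

definition total_points :: "problem \<Rightarrow> (nat \<Rightarrow> vec set) \<Rightarrow> nat" where
  "total_points pb P = (\<Sum>t = 1..horizon pb - 1. card (P t))"

text \<open>
  At the new state the gap exceeds \<open>\<delta> t\<close>, so it is farther than the separation distance from all states
  in \<open>P t\<close>; no cut is pending at stage \<open>t\<close> at that time.  Both the termination test of the first stage
  and the gap test of the other stages lead here, hence the description of the move by its effect.
\<close>

lemma nddp_inv_forward:
  assumes pb: "valid_problem pb" and inv: "nddp_inv pb \<delta> P s"
    and t: "cur_stage s = t" "t < horizon pb" and \<delta>: "\<delta> (Suc t) < \<delta> t"
    and x: "x \<in> states pb t" and gap: "ereal (\<delta> t) < over s t x - under s t x"
    and s': "cur_stage s' = Suc t" "cur_state s' = (cur_state s)(t := x)"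
      "under s' = under s" "over s' = over s"
  shows "\<exists>P'. nddp_inv pb \<delta> P' s' \<and> total_points pb P' = Suc (total_points pb P)"
proof -
  let ?N = "snorm pb t"
  have t1: "1 \<le> t" using inv t by (simp add: nddp_inv_def)
  have N: "is_norm (sdim pb t) ?N" and X: "states pb t \<subseteq> Rn (sdim pb t)" and M: "0 < reg pb (Suc t)"
    using valid_problemD[OF pb] t t1 by auto
  have Pt: "finite (P t)" "P t \<subseteq> states pb t"
      "\<And>p q. p \<in> P t \<Longrightarrow> q \<in> P t \<Longrightarrow> p \<noteq> q \<Longrightarrow> separation pb \<delta> t \<le> ?N (p - q)"
      "\<And>p. p \<in> P t \<Longrightarrow> gap_near pb t (under s t) (over s t) (\<delta> (Suc t)) p"
    using nddp_invD[OF inv t1 t(2)] t(1) by auto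
  have xR: "x \<in> Rn (sdim pb t)" using x X by blast
  have fin: "\<bar>under s t x\<bar> \<noteq> \<infinity>"
    using inv t t1 xR by (simp add: nddp_inv_def sound_approx_def)
  have sep: "separation pb \<delta> t < ?N (x - p)" if p: "p \<in> P t" for p
  proof -
    have "over s t x \<le> under s t x + ereal (\<delta> (Suc t) + 2 * reg pb (Suc t) * ?N (x - p))"
      using Pt(4)[OF p] xR by (simp add: gap_near_def)
    with gap fin have "\<delta> t < \<delta> (Suc t) + 2 * reg pb (Suc t) * ?N (x - p)"
      by (cases "under s t x"; cases "over s t x") auto
    then show ?thesis using M by (simp add: separation_def field_simps)
  qed
  have sep_pos: "0 < separation pb \<delta> t" using \<delta> M by (simp add: separation_def)
  have new: "x \<notin> P t" using sep[of x] sep_pos is_norm_zero[OF N] by auto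
  define P' where "P' = P(t := insert x (P t))"
  have sep': "separation pb \<delta> t \<le> ?N (p - q)" if "p \<in> P' t" "q \<in> P' t" "p \<noteq> q" for p q
  proof -
    have "?N (p - q) = ?N (q - p)"
      using that x Pt(2) X by (intro is_norm_minus_commute[OF N]) (auto simp: P'_def)
    then show ?thesis using that sep[of p] sep[of q] Pt(3)[of p q] by (auto simp: P'_def less_imp_le)
  qed
  have "nddp_inv pb \<delta> P' s'"
    unfolding nddp_inv_def
  proof (intro conjI allI impI)
    fix u assume u: "1 \<le> u \<and> u < horizon pb"
    have old: "finite (P u)" "P u \<subseteq> states pb u"
        "\<forall>p\<in>P u. \<forall>q\<in>P u. p \<noteq> q \<longrightarrow> separation pb \<delta> u \<le> snorm pb u (p - q)"
        "u < t \<longrightarrow> cur_state s u \<in> P u"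
        "\<forall>p\<in>P u. u < t \<and> p = cur_state s u \<or>
           gap_near pb u (under s u) (over s u) (\<delta> (Suc u)) p"
      using nddp_invD[OF inv, of u] u t(1) by blast+
    show "finite (P' u)" using old(1) by (auto simp: P'_def)
    show "P' u \<subseteq> states pb u" using old(2) x by (auto simp: P'_def)
    show "\<forall>p\<in>P' u. \<forall>q\<in>P' u. p \<noteq> q \<longrightarrow> separation pb \<delta> u \<le> snorm pb u (p - q)"
      using old sep' by (cases "u = t") (auto simp: P'_def)
    show "cur_state s' u \<in> P' u" if "u < cur_stage s'"
      using that old s' by (auto simp: P'_def)
    show "\<forall>p\<in>P' u. u < cur_stage s' \<and> p = cur_state s' u \<or>
        gap_near pb u (under s' u) (over s' u) (\<delta> (Suc u)) p"
      using old s' by (cases "u = t") (auto simp: P'_def)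
  qed (use inv t s' in \<open>simp_all add: nddp_inv_def\<close>)
  moreover have "total_points pb P' = Suc (total_points pb P)"
  proof -
    have "card (P' u) = card (P u) + (if u = t then 1 else 0)" for u
      using new Pt(1) by (simp add: P'_def)
    then show ?thesis
      using t t1 by (simp add: total_points_def sum.distrib)
  qed
  ultimately show ?thesis by blast
qed

text \<open>
  The pending cut of stage \<open>t\<close> is added, and approximations only improve.
\<close>

lemma nddp_inv_backward:
  assumes pb: "valid_problem pb" and inv: "nddp_inv pb \<delta> P s"
    and t: "cur_stage s = Suc t" "1 \<le> t"
    and V: "affine_fun (sdim pb t) V"
      "lipschitz_fun (sdim pb t) (snorm pb t) (reg pb (Suc t)) V"
      "\<And>z. z \<in> states pb t \<Longrightarrow> ereal (V z) \<le> reg_ctg pb t z"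
    and v: "reg_ctg pb t (cur_state s t) \<le> v" "v - ereal (V (cur_state s t)) \<le> ereal (\<delta> (Suc t))"
    and s': "cur_stage s' = t" "cur_state s' = (cur_state s)(Suc t := x)"
      "under s' = (under s)(t := (\<lambda>z. max (under s t z) (ereal (V z))))"
      "over s' = (over s)(t := over_cut pb t (cur_state s t) v (over s t))"
  shows "nddp_inv pb \<delta> P s'"
proof -
  let ?xp = "cur_state s t"
  have t': "t < horizon pb" using inv t by (simp add: nddp_inv_def)
  have N: "is_norm (sdim pb t) (snorm pb t)" and X: "states pb t \<subseteq> Rn (sdim pb t)"
    using valid_problemD[OF pb] t t' by auto
  have xp: "?xp \<in> Rn (sdim pb t)"
    using nddp_invD(2,4)[OF inv t(2) t'] t(1) X by auto
  show ?thesis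
    unfolding nddp_inv_def
  proof (intro conjI allI impI)
    fix u assume u: "1 \<le> u \<and> u \<le> horizon pb"
    show "sound_approx pb u (under s' u) (over s' u)"
      using inv u s' sound_approx_update[OF pb t(2) t' _ xp V(1,3) v(1)]
      by (cases "u = t") (auto simp: nddp_inv_def)
  next
    fix u assume u: "1 \<le> u \<and> u < horizon pb"
    have old: "finite (P u)" "P u \<subseteq> states pb u"
        "\<forall>p\<in>P u. \<forall>q\<in>P u. p \<noteq> q \<longrightarrow> separation pb \<delta> u \<le> snorm pb u (p - q)"
        "u < Suc t \<longrightarrow> cur_state s u \<in> P u"
        "\<forall>p\<in>P u. u < Suc t \<and> p = cur_state s u \<or>
           gap_near pb u (under s u) (over s u) (\<delta> (Suc u)) p"
      using nddp_invD[OF inv, of u] u t(1) by (metis, metis, metis, metis, metis)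
    show "finite (P u)" "P u \<subseteq> states pb u"
      "\<forall>p\<in>P u. \<forall>q\<in>P u. p \<noteq> q \<longrightarrow> separation pb \<delta> u \<le> snorm pb u (p - q)"
      by (fact old)+
    show "cur_state s' u \<in> P u" if "u < cur_stage s'"
      using that old s' by auto
    show "\<forall>p\<in>P u. u < cur_stage s' \<and> p = cur_state s' u \<or>
        gap_near pb u (under s' u) (over s' u) (\<delta> (Suc u)) p"
    proof (cases "u = t")
      case True
      have "gap_near pb t (under s' t) (over s' t) (\<delta> (Suc t)) p" if "p \<in> P t" for p
      proof (cases "p = ?xp")
        case True
        then show ?thesis
          using gap_near_update[OF N xp V(2) v(2)] s' by simp
      next
        case False
        then have "gap_near pb t (under s t) (over s t) (\<delta> (Suc t)) p"
          using old(5) that \<open>u = t\<close> by auto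
        then show ?thesis
          by (rule gap_near_mono) (auto simp: s' over_cut_def conv_min_le)
      qed
      then show ?thesis using True by simp
    next
      case False
      then show ?thesis using old s' by auto
    qed
  qed (use inv t t' s' in \<open>simp_all add: nddp_inv_def\<close>)
qed

lemma nddp_inv_init:
  assumes pb: "valid_problem pb"
  shows "nddp_inv pb \<delta> (\<lambda>t. {}) (nddp_init pb)"
proof -
  have zero: "lsc_on S (\<lambda>x. 0)" "convex S \<Longrightarrow> ereal_convex_on S (\<lambda>x. 0)" for S :: "vec set"
    using lsc_on_continuous[of S "\<lambda>x. 0"] ereal_convex_on_real[of S "\<lambda>x. 0"]
    by (simp_all add: zero_ereal_def[symmetric] convex_on_def)
  have infty: "lsc_on S (\<lambda>x. \<infinity>)" "ereal_convex_on S (\<lambda>x. \<infinity>)" for S :: "vec set"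
    by (auto simp: ereal_convex_on_def intro!: lsc_onI_real)
  have "sound_approx pb t (\<lambda>x. 0) (\<lambda>x. if t < horizon pb then \<infinity> else 0)" if "1 \<le> t" "t \<le> horizon pb" for t
    unfolding sound_approx_def
    using zero infty convex_Rn reg_ctg_nonneg[OF pb that] valid_problemD(3)[OF pb that] that
    by (auto simp: reg_ctg.simps[of pb "horizon pb"])
  then show ?thesis
    using valid_problemD(1)[OF pb] by (auto simp: nddp_inv_def nddp_init_def)
qed

text \<open>
  The counting identity says that \<open>2 * total_points pb P - cur_stage s\<close> grows by one in every step:
  forward by \<open>2 - 1\<close>, backward by \<open>0 + 1\<close>.
\<close>

lemma nddp_step_inv:
  assumes pb: "valid_problem pb" and orc1: "valid_initial_oracle pb orc1"
    and orc: "\<forall>t\<in>{2..horizon pb}. valid_stage_oracle pb t (orc t)"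
    and \<delta>: "\<forall>t\<in>{1..horizon pb - 1}. \<delta> (t + 1) < \<delta> t" "\<delta> (horizon pb) = 0"
    and inv: "nddp_inv pb \<delta> P s" and running: "\<not> terminated s"
    and running': "\<not> terminated (nddp_step pb orc1 orc (\<delta> 1) \<delta> s)"
  shows "\<exists>P'. nddp_inv pb \<delta> P' (nddp_step pb orc1 orc (\<delta> 1) \<delta> s) \<and>
    2 * total_points pb P' + cur_stage s
      = 2 * total_points pb P + cur_stage (nddp_step pb orc1 orc (\<delta> 1) \<delta> s) + 1"
proof (cases "cur_stage s = 1")
  case True
  define s' where "s' = nddp_step pb orc1 orc (\<delta> 1) \<delta> s"
  have s'_eq: "s' = nddp_initial_step pb orc1 (\<delta> 1) s"
    using True running by (simp add: s'_def nddp_step_def)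
  obtain x \<gamma> where o: "orc1 (under s 1) (over s 1) = (x, \<gamma>)" by fastforce
  let ?c = "\<lambda>x. cost pb 1 (init_state pb) x (init_uncert pb)"
  have T: "2 \<le> horizon pb" by (rule valid_problemD(1)[OF pb])
  have sound: "sound_approx pb 1 (under s 1) (over s 1)"
    using inv T by (simp add: nddp_inv_def)
  then have "approx_pair pb 1 (under s 1) (over s 1)"
    using T by (intro sound_approx_imp_approx_pair[OF pb]) auto
  then have x: "x \<in> states pb 1" "\<And>y. y \<in> states pb 1 \<Longrightarrow> ?c x + under s 1 x \<le> ?c y + under s 1 y"
    using orc1 o unfolding valid_initial_oracle_def by force+
  have X: "states pb 1 \<subseteq> Rn (sdim pb 1)" using valid_problemD(3)[OF pb] T by simp
  have fin: "\<bar>under s 1 y\<bar> \<noteq> \<infinity>" "reg_ctg pb 1 y \<le> over s 1 y" if "y \<in> states pb 1" for y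
    using sound subsetD[OF X that] unfolding sound_approx_def by simp_all
  obtain y where y: "y \<in> states pb 1" "?c y < \<infinity>"
    using valid_problem_conjuncts(8)[OF pb] by blast
  have "?c x + under s 1 x < \<infinity>"
    using x(2)[OF y(1)] y(2) fin(1)[OF y(1)] by (cases "?c y"; cases "under s 1 y") auto
  moreover have "0 \<le> ?c x"
  proof -
    have "1 \<in> {1..horizon pb}" using T by simp
    from bspec[OF valid_problem_conjuncts(6)[OF pb] this]
    show ?thesis
      using valid_problem_conjuncts(3,4)[OF pb] x(1) X by auto
  qed
  \<comment> \<open>Finiteness makes the difference of the two bounds at \<open>x\<close> equal to the gap there.\<close>
  ultimately obtain c l where c: "?c x = ereal c" and l: "under s 1 x = ereal l"
    using fin(1)[OF x(1)] by (cases "?c x"; cases "under s 1 x") auto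
  define ub where "ub = (if ?c x + over s 1 x < ubound s then ?c x + over s 1 x else ubound s)"
  have s'_unfold: "s' = (let s'' = s\<lparr>cur_state := (cur_state s)(1 := x), lbound := ?c x + under s 1 x, ubound := ub,
        incumbent := if ?c x + over s 1 x < ubound s then Some x else incumbent s\<rparr>
      in if ub - (?c x + under s 1 x) \<le> ereal (\<delta> 1) then s''\<lparr>terminated := True\<rparr> else s''\<lparr>cur_stage := 2\<rparr>)"
    unfolding s'_eq nddp_initial_step_def o ub_def by (simp only: Let_def prod.case)
  have not_done: "\<not> ub - (?c x + under s 1 x) \<le> ereal (\<delta> 1)"
  proof
    assume "ub - (?c x + under s 1 x) \<le> ereal (\<delta> 1)"
    then have "terminated s'" unfolding s'_unfold by (simp add: Let_def)
    then show False using running' by (simp add: s'_def)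
  qed
  have "ereal (\<delta> 1) < over s 1 x - under s 1 x"
  proof (rule ccontr)
    assume "\<not> ?thesis"
    moreover have "ub \<le> ?c x + over s 1 x" by (simp add: ub_def not_less)
    ultimately have "ub - (?c x + under s 1 x) \<le> ereal (\<delta> 1)"
      unfolding c l by (cases "over s 1 x"; cases ub) auto
    then show False using not_done by simp
  qed
  moreover have "cur_stage s' = Suc 1" "cur_state s' = (cur_state s)(1 := x)"
      "under s' = under s" "over s' = over s"
    using not_done unfolding s'_unfold by (simp_all add: Let_def)
  ultimately have "\<exists>P'. nddp_inv pb \<delta> P' s' \<and> total_points pb P' = Suc (total_points pb P)"
    using T \<delta>(1) by (intro nddp_inv_forward[OF pb inv True _ _ x(1)]) auto
  then show ?thesis
    using True \<open>cur_stage s' = Suc 1\<close> unfolding s'_def[symmetric] by auto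
next
  case False
  define s' where "s' = nddp_step pb orc1 orc (\<delta> 1) \<delta> s"
  have s'_eq: "s' = nddp_stage_step pb orc \<delta> s"
    using False running by (simp add: s'_def nddp_step_def)
  obtain t where t: "cur_stage s = Suc t" "1 \<le> t" "Suc t \<le> horizon pb"
    using inv False by (cases "cur_stage s") (auto simp: nddp_inv_def)
  let ?xp = "cur_state s t"
  obtain V v x \<gamma> where o: "orc (Suc t) ?xp (under s (Suc t)) (over s (Suc t)) = (V, v, x, \<gamma>)"
    using prod_cases4 by blast
  have xp: "?xp \<in> states pb t"
    using nddp_invD(2,4)[OF inv t(2)] t by auto
  have "sound_approx pb (Suc t) (under s (Suc t)) (over s (Suc t))"
    using inv t by (simp add: nddp_inv_def)
  then have "approx_pair pb (Suc t) (under s (Suc t)) (over s (Suc t))"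
    using t by (intro sound_approx_imp_approx_pair[OF pb]) auto
  moreover have "valid_stage_oracle pb (Suc t) (orc (Suc t))"
    using orc t by auto
  ultimately have spec: "x \<in> states pb (Suc t)" "affine_fun (sdim pb t) V"
      "lipschitz_fun (sdim pb t) (snorm pb t) (reg pb (Suc t)) V"
      "\<And>z. z \<in> states pb t \<Longrightarrow> ereal (V z) \<le> reg_ctg pb t z"
      "reg_ctg pb t ?xp \<le> v" "v - ereal (V ?xp) \<le> \<gamma>" "\<gamma> = over s (Suc t) x - under s (Suc t) x"
    using o xp unfolding valid_stage_oracle_def by force+
  show ?thesis
  proof (cases "Suc t < horizon pb \<and> \<gamma> > ereal (\<delta> (Suc t))")
    case True
    then have "cur_stage s' = Suc (Suc t)" "cur_state s' = (cur_state s)(Suc t := x)"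
      "under s' = under s" "over s' = over s"
      unfolding s'_eq nddp_stage_step_def by (auto simp: t o Let_def)
    moreover from this have "\<exists>P'. nddp_inv pb \<delta> P' s' \<and> total_points pb P' = Suc (total_points pb P)"
      using True \<delta>(1) t spec by (intro nddp_inv_forward[OF pb inv t(1) _ _ spec(1)]) auto
    ultimately show ?thesis unfolding s'_def[symmetric] t(1) by auto
  next
    case bwd: False
    then have s': "cur_stage s' = t" "cur_state s' = (cur_state s)(Suc t := x)"
      "under s' = (under s)(t := (\<lambda>z. max (under s t z) (ereal (V z))))"
      "over s' = (over s)(t := over_cut pb t ?xp v (over s t))"
      unfolding s'_eq nddp_stage_step_def over_cut_def by (auto simp: t o Let_def)
    \<comment> \<open>At the horizon both approximations vanish, and so does \<open>\<delta>\<close>.\<close>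
    have "\<gamma> \<le> ereal (\<delta> (Suc t))"
    proof (cases "Suc t < horizon pb")
      case False
      then have "Suc t = horizon pb" using t by simp
      then show ?thesis using inv spec(7) \<delta>(2) by (simp add: nddp_inv_def)
    qed (use bwd in auto)
    then have "v - ereal (V ?xp) \<le> ereal (\<delta> (Suc t))" using spec(6) by (rule order_trans[rotated])
    then have "nddp_inv pb \<delta> P s'"
      by (intro nddp_inv_backward[OF pb inv t(1,2) spec(2-5) _ s'])
    then show ?thesis unfolding s'_def[symmetric] t(1) s'(1) by auto
  qed
qed

lemma nddp_run_inv:
  assumes pb: "valid_problem pb" and orc1: "valid_initial_oracle pb orc1"
    and orc: "\<forall>t\<in>{2..horizon pb}. valid_stage_oracle pb t (orc t)"
    and \<delta>: "\<forall>t\<in>{1..horizon pb - 1}. \<delta> (t + 1) < \<delta> t" "\<delta> (horizon pb) = 0"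
    and "\<not> terminated (nddp_run pb orc1 orc (\<delta> 1) \<delta> n)"
  shows "\<exists>P. nddp_inv pb \<delta> P (nddp_run pb orc1 orc (\<delta> 1) \<delta> n) \<and>
    n + cur_stage (nddp_run pb orc1 orc (\<delta> 1) \<delta> n) = 2 * total_points pb P + 1"
  using assms(6)
proof (induction n)
  case 0
  show ?case
    using nddp_inv_init[OF pb]
    by (intro exI[of _ "\<lambda>t. {}"]) (simp add: nddp_run_def total_points_def nddp_init_def)
next
  case (Suc n)
  let ?s = "nddp_run pb orc1 orc (\<delta> 1) \<delta> n"
  have step: "nddp_run pb orc1 orc (\<delta> 1) \<delta> (Suc n) = nddp_step pb orc1 orc (\<delta> 1) \<delta> ?s"
    by (simp add: nddp_run_def)
  have running: "\<not> terminated ?s"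
    using Suc.prems unfolding step by (auto simp: nddp_step_def)
  then obtain P where P: "nddp_inv pb \<delta> P ?s" "n + cur_stage ?s = 2 * total_points pb P + 1"
    using Suc.IH by blast
  from nddp_step_inv[OF pb orc1 orc \<delta> P(1) running Suc.prems[unfolded step]] P(2)
  show ?case unfolding step by auto
qed

lemma total_points_le:
  assumes pb: "valid_problem pb" and inv: "nddp_inv pb \<delta> P s"
    and \<delta>: "\<forall>t\<in>{1..horizon pb - 1}. \<delta> (t + 1) < \<delta> t"
    and D: "\<forall>t\<in>{1..horizon pb - 1}. 0 < D t \<and>
           (\<exists>c\<in>Rn (sdim pb t).
              states pb t \<subseteq> {x \<in> Rn (sdim pb t). snorm pb t (x - c) \<le> D t / 2})"
  shows "real (total_points pb P) \<le> (\<Sum>t = 1..horizon pb - 1.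
           (1 + 2 * reg pb (t + 1) * D t / (\<delta> t - \<delta> (t + 1))) ^ sdim pb t)"
  unfolding total_points_def of_nat_sum
proof (rule sum_mono)
  fix t assume t: "t \<in> {1..horizon pb - 1}"
  then have t': "1 \<le> t" "t < horizon pb" "t \<le> horizon pb" by auto
  note N = valid_problemD(2)[OF pb t'(3)] and M = valid_problemD(4)[OF pb t'(1,2)]
  obtain c where c: "c \<in> Rn (sdim pb t)"
      "states pb t \<subseteq> {x \<in> Rn (sdim pb t). snorm pb t (x - c) \<le> D t / 2}" and Dt: "0 < D t"
    using D t by blast
  have \<delta>t: "\<delta> (Suc t) < \<delta> t" using \<delta> t by auto
  have P: "finite (P t)" "P t \<subseteq> states pb t"
      "\<And>p q. p \<in> P t \<Longrightarrow> q \<in> P t \<Longrightarrow> p \<noteq> q \<Longrightarrow> separation pb \<delta> t \<le> snorm pb t (p - q)"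
    using nddp_invD(1-3)[OF inv t'(1,2)] by auto
  have "real (card (P t)) \<le> (1 + D t / separation pb \<delta> t) ^ sdim pb t"
  proof (rule card_separated_le[OF N P(1) c(1)])
    show "0 < separation pb \<delta> t" using \<delta>t M by (simp add: separation_def)
  qed (use Dt P c in \<open>auto simp: subset_iff\<close>)
  also have "D t / separation pb \<delta> t = 2 * reg pb (t + 1) * D t / (\<delta> t - \<delta> (t + 1))"
    by (simp add: separation_def)
  finally show "real (card (P t)) \<le> (1 + 2 * reg pb (t + 1) * D t / (\<delta> t - \<delta> (t + 1))) ^ sdim pb t" .
qed

theorem theorem2:
  fixes pb :: problem
    and orc1 :: initial_oracle
    and orc :: "nat \<Rightarrow> stage_oracle"
    and \<delta> D :: "nat \<Rightarrow> real"
    and \<epsilon> :: real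
  assumes "valid_problem pb"
    and "valid_initial_oracle pb orc1"
    and "\<forall>t\<in>{2..horizon pb}. valid_stage_oracle pb t (orc t)"
    and "\<epsilon> = \<delta> 1"
    and "\<forall>t\<in>{1..horizon pb - 1}. \<delta> (t + 1) < \<delta> t"
    and "\<delta> (horizon pb) = 0"
    and "\<forall>t\<in>{1..horizon pb - 1}. 0 < D t \<and>
           (\<exists>c\<in>Rn (sdim pb t).
              states pb t \<subseteq> {x \<in> Rn (sdim pb t). snorm pb t (x - c) \<le> D t / 2})"
  shows "nddp_terminates pb orc1 orc \<epsilon> \<delta> \<and>
         real (nddp_evals pb orc1 orc \<epsilon> \<delta>)
           \<le> 1 + 2 * (\<Sum>t = 1..horizon pb - 1.
                  (1 + 2 * reg pb (t + 1) * D t / (\<delta> t - \<delta> (t + 1))) ^ sdim pb t)"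
proof -
  let ?B = "\<Sum>t = 1..horizon pb - 1. (1 + 2 * reg pb (t + 1) * D t / (\<delta> t - \<delta> (t + 1))) ^ sdim pb t"
  let ?run = "nddp_run pb orc1 orc \<epsilon> \<delta>"
  have bound: "real n \<le> 2 * ?B" if "\<not> terminated (?run n)" for n
  proof -
    have "\<exists>P. nddp_inv pb \<delta> P (?run n) \<and> n + cur_stage (?run n) = 2 * total_points pb P + 1"
      using nddp_run_inv[OF assms(1-3,5,6) that[unfolded assms(4)]] unfolding assms(4) .
    then obtain P where P: "nddp_inv pb \<delta> P (?run n)"
        "n + cur_stage (?run n) = 2 * total_points pb P + 1" by blast
    have "1 \<le> cur_stage (?run n)" using P(1) by (simp add: nddp_inv_def)
    then have "real n \<le> 2 * real (total_points pb P)" using P(2) by linarith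
    then show ?thesis using total_points_le[OF assms(1) P(1) assms(5,7)] by linarith
  qed
  obtain m where "2 * ?B < real m" using reals_Archimedean2 by blast
  then have ends: "\<exists>n. terminated (?run n)" using bound[of m] by (intro exI[of _ m]) linarith
  define n where "n = nddp_evals pb orc1 orc \<epsilon> \<delta>"
  have "terminated (?run n)" using ends unfolding n_def nddp_evals_def by (rule LeastI_ex)
  then have "n \<noteq> 0" by (cases n) (auto simp: nddp_run_def nddp_init_def)
  then have "\<not> terminated (?run (n - 1))"
    unfolding n_def nddp_evals_def by (intro not_less_Least) simp
  then have "real (n - 1) \<le> 2 * ?B" by (rule bound)
  then have "real n \<le> 1 + 2 * ?B" using \<open>n \<noteq> 0\<close> by simp
  then show ?thesis using ends by (simp add: nddp_terminates_def n_def)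
qed

end
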